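(* For each $n$ with $1\le n\le 36$, the center density of every sphere packing in $\mathbb{R}^n$ is at most $U_n$, where $U_{1}=0.5$, $U_{2}=0.28868$, $U_{3}=0.18616$, $U_{4}=0.13126$, $U_{5}=0.09975$, $U_{6}=0.08084$, $U_{7}=0.06933$, $U_{8}=0.06251$, $U_{9}=0.05900$, $U_{10}=0.05804$, $U_{11}=0.05932$, $U_{12}=0.06279$, $U_{13}=0.06870$, $U_{14}=0.07750$, $U_{15}=0.08999$, $U_{16}=0.10738$, $U_{17}=0.13150$, $U_{18}=0.16503$, $U_{19}=0.21202$, $U_{20}=0.27855$, $U_{21}=0.37389$, $U_{22}=0.51231$, $U_{23}=0.71601$, $U_{24}=1.01998$, $U_{25}=1.48001$, $U_{26}=2.18614$, $U_{27}=3.28537$, $U_{28}=5.02059$, $U_{29}=7.79782$, $U_{30}=12.30390$, $U_{31}=19.71397$, $U_{32}=32.06222$, $U_{33}=52.90924$, $U_{34}=88.55925$, $U_{35}=150.29783$, $U_{36}=258.54994$.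
   Context: A sphere packing in $\mathbb{R}^n$ is a collection $\mathcal P$ of congruent closed balls (of positive radius) that do not intersect except along their boundaries. Its density $\Delta$ is the fraction of space covered by the balls, taken in general to be the upper density $$\Delta=\limsup_{r\to\infty}\ \sup_{p\in\mathbb{R}^n}\frac{\operatorname{vol}(B(p,r)\cap\mathcal P)}{\operatorname{vol}B(p,r)},$$ where $B(p,r)$ is the ball of radius $r$ centered at $p$ and $B(p,r)\cap\mathcal P$ denotes the part of $B(p,r)$ covered by the balls of $\mathcal P$. The center density $\delta$ of the packing is defined by $\Delta=\frac{\pi^{n/2}}{(n/2)!}\,\delta$ (the number of sphere centers per unit volume when the packing is scaled to use unit spheres), where $(n/2)!$ means $\Gamma(n/2+1)$. *)

theory Defs
  imports "HOL-Analysis.Analysis"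
begin

definition sphere_packing :: "(real ^ 'n) set set \<Rightarrow> bool" where
  "sphere_packing P \<longleftrightarrow>
     (\<exists>\<rho>>0. \<forall>B\<in>P. \<exists>c. B = cball c \<rho>) \<and>
     (\<forall>B\<in>P. \<forall>B'\<in>P. B \<noteq> B' \<longrightarrow> B \<inter> B' \<subseteq> frontier B \<inter> frontier B')"

(* Extended reals are used only so that the limit superior and supremum are taken in a
   complete lattice; the quotients are real numbers in [0,1] for r > 0. *)
definition upper_density :: "(real ^ 'n) set set \<Rightarrow> ereal" where
  "upper_density P =
     Limsup at_top (\<lambda>r::real. SUP p. ereal
       (measure lebesgue (ball p r \<inter> \<Union>P) / measure lebesgue (ball p r)))"

definition center_density :: "(real ^ 'n) set set \<Rightarrow> ereal" where
  "center_density P =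
     upper_density P / ereal (pi powr (real CARD('n) / 2) / Gamma (real CARD('n) / 2 + 1))"

lemma upper_density_eq_center_density:
  fixes P :: "(real ^ 'n) set set"
  shows "upper_density P =
    ereal (pi powr (real CARD('n) / 2) / Gamma (real CARD('n) / 2 + 1)) * center_density P"
proof -
  have "Gamma (real CARD('n) / 2 + 1) > 0"
    by (rule Gamma_real_pos) simp
  then have "Gamma (real CARD('n) / 2 + 1) \<noteq> 0"
    by linarith
  then show ?thesis
    unfolding center_density_def
    by (cases "upper_density P") (auto simp del: Gamma_eq_zero_iff)
qed

definition packing_bound :: "nat \<Rightarrow> real" where
  "packing_bound n =
    [0.5, 0.28868, 0.18616, 0.13126, 0.09975, 0.08084,
     0.06933, 0.06251, 0.05900, 0.05804, 0.05932, 0.06279,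
     0.06870, 0.07750, 0.08999, 0.10738, 0.13150, 0.16503,
     0.21202, 0.27855, 0.37389, 0.51231, 0.71601, 1.01998,
     1.48001, 2.18614, 3.28537, 5.02059, 7.79782, 12.30390,
     19.71397, 32.06222, 52.90924, 88.55925, 150.29783, 258.54994] ! (n - 1)"

end

theory Submission
  imports Defs "HOL-Probability.Characteristic_Functions" "HOL-Real_Asymp.Real_Asymp"
begin

text \<open>
  The bounds are linear programming bounds in the sense of Cohn and Elkies. Let \<open>f\<close> be an integrable
  function with integral \<open>F > 0\<close> that is the Fourier transform of a nonnegative integrable function and satisfies
  \<open>f x \<le> 0\<close> whenever \<open>|x|\<close> is at least the minimal distance of the centers of a packing. Then there are
  asymptotically at most \<open>f 0 / F\<close> centers per unit volume. Instead of Poisson summation, the proof uses that \<open>f\<close> is positive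
  definite: for \<open>N\<close> centers in a large ball of volume \<open>V\<close>, integrate \<open>f (x - y)\<close> against \<open>\<mu> \<times> \<mu>\<close> for the signed measure
  \<open>\<mu>\<close> that has mass 1 at each center and constant density \<open>- N / V\<close> on the ball. The result is nonnegative
  (\<open>positive_definite_signed\<close>). The sum over pairs of centers is at most \<open>N * f 0\<close>, and the mixed and the continuous
  terms together contribute about \<open>- N * (N / V) * F\<close>, whence \<open>N / V\<close> is at most about \<open>f 0 / F\<close>. This works for arbitrary,
  also non-periodic, packings and gives a bound for the upper density (\<open>upper_density_le\<close>).

  The functions used are polynomials in \<open>|x|\<^sup>2\<close> times a Gaussian. Their Fourier transforms have the same
  form, and after multiplication of the coefficients by rising factorials the transform of the polynomial is the
  substitution \<open>x \<mapsto> 1 - x\<close> (\<open>gaussian_poly_transform\<close>). So a function for dimension \<open>n\<close> amounts to a polynomial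
  of degree between 19 and 27 with two sign conditions on half-lines. Both are certified by writing a polynomial as
  \<open>A\<^sup>2 + s * B\<^sup>2\<close> with integer polynomials \<open>A\<close> and \<open>B\<close>, exactly for the function (with \<open>s\<close> shifted) and
  coefficientwise from below for its transform (\<open>certificate\<close>). The polynomials come from a numerical
  solution of the linear program; the proof checks them in integer arithmetic.

  For dimension 1 the bound \<open>1 / 2\<close> is the trivial statement that the density is at most 1.
\<close>

section \<open>Fourier transforms of Gaussians\<close>

text \<open>
  The characteristic function of the standard normal distribution, rescaled by \<open>sqrt (2 * pi * u)\<close>.
\<close>

lemma fourier_gaussian_real:
  fixes u c :: real
  assumes "u > 0"
  shows "has_bochner_integral lborel (\<lambda>y. complex_of_real (exp (- pi * u * y\<^sup>2)) * iexp (c * y))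
           (complex_of_real (exp (- c\<^sup>2 / (4 * pi * u)) / sqrt u))"
proof -
  define s where "s = sqrt (2 * pi * u)"
  have s: "s > 0" "s\<^sup>2 = 2 * pi * u" using assms by (simp_all add: s_def)
  let ?g = "\<lambda>x. std_normal_density x *\<^sub>R iexp (c / s * x)"
  interpret real_distribution std_normal_distribution
    by (rule real_dist_normal_dist)
  have int: "integrable lborel ?g"
  proof -
    have "complex_integrable std_normal_distribution (\<lambda>x. iexp (c / s * x))"
      by (rule integrable_iexp) auto
    then show ?thesis
      by (subst (asm) integrable_density) (auto intro: normal_density_nonneg)
  qed
  have "(\<integral>x. ?g x \<partial>lborel) = char std_normal_distribution (c / s)"
    unfolding char_def by (subst integral_density) (auto intro: normal_density_nonneg)
  also have "\<dots> = complex_of_real (exp (- c\<^sup>2 / (4 * pi * u)))"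
    by (simp add: char_std_normal_distribution power_divide s)
  finally have val: "(\<integral>x. ?g x \<partial>lborel) = complex_of_real (exp (- c\<^sup>2 / (4 * pi * u)))" .
  have eq: "?g (s * y) = (1 / sqrt (2 * pi)) *\<^sub>R (complex_of_real (exp (- pi * u * y\<^sup>2)) * iexp (c * y))" for y
    using s by (simp add: std_normal_density_def power_mult_distrib scaleR_conv_of_real mult_ac)
  have "integrable lborel (\<lambda>y. ?g (0 + s * y))"
    using lborel_integrable_real_affine[OF int, of s 0] s by simp
  then have "integrable lborel (\<lambda>y. sqrt (2 * pi) *\<^sub>R ?g (0 + s * y))"
    by (rule integrable_scaleR_right)
  then have i2: "integrable lborel (\<lambda>y. complex_of_real (exp (- pi * u * y\<^sup>2)) * iexp (c * y))"
    unfolding add_0 eq scaleR_scaleR by simp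
  have "(\<integral>x. ?g x \<partial>lborel) = s *\<^sub>R (\<integral>y. ?g (0 + s * y) \<partial>lborel)"
    using lborel_integral_real_affine[of s ?g 0] s by simp
  also have "(\<lambda>y. ?g (0 + s * y)) = (\<lambda>y. (1 / sqrt (2 * pi)) *\<^sub>R (complex_of_real (exp (- pi * u * y\<^sup>2)) * iexp (c * y)))"
    using eq by (intro ext) simp
  also have "s *\<^sub>R (\<integral>y. (1 / sqrt (2 * pi)) *\<^sub>R (complex_of_real (exp (- pi * u * y\<^sup>2)) * iexp (c * y)) \<partial>lborel)
      = sqrt u *\<^sub>R (\<integral>y. complex_of_real (exp (- pi * u * y\<^sup>2)) * iexp (c * y) \<partial>lborel)"
    using assms by (simp add: s_def real_sqrt_mult)
  finally have "(\<integral>y. complex_of_real (exp (- pi * u * y\<^sup>2)) * iexp (c * y) \<partial>lborel)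
      = complex_of_real (exp (- c\<^sup>2 / (4 * pi * u)) / sqrt u)"
    unfolding val using assms by (simp add: scaleR_conv_of_real field_simps)
  with i2 show ?thesis by (simp add: has_bochner_integral_iff)
qed

text \<open>
  Fubini for integrands that are a product of functions of the single coordinates.
\<close>

lemma has_bochner_integral_lborel_prod:
  fixes f :: "'a::euclidean_space \<Rightarrow> real \<Rightarrow> complex"
  assumes "\<And>b. b \<in> Basis \<Longrightarrow> has_bochner_integral lborel (f b) (v b)"
  shows "has_bochner_integral lborel (\<lambda>x::'a. \<Prod>b\<in>Basis. f b (x \<bullet> b)) (\<Prod>b\<in>Basis. v b)"
proof -
  interpret product_sigma_finite "\<lambda>b::'a. lborel :: real measure" ..
  have f: "integrable lborel (f b)" "integral\<^sup>L lborel (f b) = v b" if "b \<in> Basis" for b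
    using assms[OF that] by (auto simp: has_bochner_integral_iff)
  have [measurable]: "f b \<in> borel_measurable borel" if "b \<in> Basis" for b
    using borel_measurable_integrable[OF f(1)[OF that]] by simp
  have m: "(\<lambda>x::'a. \<Prod>b\<in>Basis. f b (x \<bullet> b)) \<in> borel_measurable borel"
    by measurable
  have ms: "(\<lambda>g. \<Sum>b\<in>Basis. g b *\<^sub>R b) \<in> (\<Pi>\<^sub>M b\<in>(Basis::'a set). lborel) \<rightarrow>\<^sub>M (borel :: 'a measure)"
    by measurable
  have c: "(\<Prod>b\<in>Basis. f b ((\<Sum>b'\<in>Basis. g b' *\<^sub>R b') \<bullet> b)) = (\<Prod>b\<in>Basis. f b (g b))" for g
    by (intro prod.cong refl) (simp add: inner_sum_left inner_Basis if_distrib sum.delta cong: if_cong)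
  show ?thesis
    unfolding has_bochner_integral_iff
    by (subst (1) lborel_eq, subst (2) lborel_eq)
       (simp add: integrable_distr_eq[OF ms m] integral_distr[OF ms m] c f product_integrable_prod product_integral_prod)
qed

lemma fourier_gaussian:
  fixes x :: "'a::euclidean_space"
  assumes "u > 0"
  shows "has_bochner_integral lborel (\<lambda>y. exp (- pi * u * (norm y)\<^sup>2) * cos (2 * pi * (x \<bullet> y)))
           (u powr (- real DIM('a) / 2) * exp (- pi * (norm x)\<^sup>2 / u))"
proof -
  have "has_bochner_integral lborel
      (\<lambda>y::'a. \<Prod>b\<in>Basis. complex_of_real (exp (- pi * u * (y \<bullet> b)\<^sup>2)) * iexp ((2 * pi * (x \<bullet> b)) * (y \<bullet> b)))
      (\<Prod>b\<in>Basis. complex_of_real (exp (- (2 * pi * (x \<bullet> b))\<^sup>2 / (4 * pi * u)) / sqrt u))"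
    by (intro has_bochner_integral_lborel_prod fourier_gaussian_real assms)
  also have "(\<Prod>b\<in>Basis. complex_of_real (exp (- (2 * pi * (x \<bullet> b))\<^sup>2 / (4 * pi * u)) / sqrt u))
      = complex_of_real (u powr (- real DIM('a) / 2) * exp (- pi * (norm x)\<^sup>2 / u))"
  proof -
    have "(\<Prod>b\<in>(Basis::'a set). exp (- (2 * pi * (x \<bullet> b))\<^sup>2 / (4 * pi * u)) / sqrt u)
        = (\<Prod>b\<in>(Basis::'a set). exp (- pi / u * (x \<bullet> b)\<^sup>2) * (1 / sqrt u))"
      using assms by (intro prod.cong refl) (simp add: field_simps power2_eq_square)
    also have "\<dots> = exp (- pi / u * (\<Sum>b\<in>Basis. (x \<bullet> b)\<^sup>2)) * (1 / sqrt u) ^ DIM('a)"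
      by (subst prod.distrib) (simp only: exp_sum[OF finite_Basis] sum_distrib_left prod_constant)
    also have "(\<Sum>b\<in>Basis. (x \<bullet> b)\<^sup>2) = (norm x)\<^sup>2"
      by (simp only: power2_norm_eq_inner euclidean_inner[of x x]) (simp add: power2_eq_square)
    also have "(1 / sqrt u) ^ DIM('a) = u powr (- real DIM('a) / 2)"
      using assms by (simp add: powr_half_sqrt[symmetric] powr_minus_divide powr_powr powr_realpow[symmetric] power_one_over)
    finally show ?thesis
      by (subst of_real_prod[symmetric]) simp
  qed
  also have "(\<lambda>y::'a. \<Prod>b\<in>Basis. complex_of_real (exp (- pi * u * (y \<bullet> b)\<^sup>2)) * iexp ((2 * pi * (x \<bullet> b)) * (y \<bullet> b)))
      = (\<lambda>y. complex_of_real (exp (- pi * u * (norm y)\<^sup>2)) * iexp (2 * pi * (x \<bullet> y)))"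
  proof
    fix y :: 'a
    have "(\<Prod>b\<in>Basis. complex_of_real (exp (- pi * u * (y \<bullet> b)\<^sup>2)) * iexp ((2 * pi * (x \<bullet> b)) * (y \<bullet> b)))
      = complex_of_real (exp (\<Sum>b\<in>Basis. - pi * u * (y \<bullet> b)\<^sup>2)) * exp (\<Sum>b\<in>Basis. \<i> * of_real ((2 * pi * (x \<bullet> b)) * (y \<bullet> b)))"
      by (simp add: prod.distrib exp_sum)
    also have "(\<Sum>b\<in>Basis. - pi * u * (y \<bullet> b)\<^sup>2) = - pi * u * (norm y)\<^sup>2"
      by (simp only: power2_norm_eq_inner euclidean_inner[of y y] sum_distrib_left)
        (simp add: power2_eq_square)
    also have "(\<Sum>b\<in>Basis. \<i> * of_real ((2 * pi * (x \<bullet> b)) * (y \<bullet> b))) = \<i> * of_real (2 * pi * (x \<bullet> y))"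
      by (simp add: euclidean_inner[of x y] sum_distrib_left mult.assoc)
    finally show "(\<Prod>b\<in>Basis. complex_of_real (exp (- pi * u * (y \<bullet> b)\<^sup>2)) * iexp ((2 * pi * (x \<bullet> b)) * (y \<bullet> b)))
       = complex_of_real (exp (- pi * u * (norm y)\<^sup>2)) * iexp (2 * pi * (x \<bullet> y))" .
  qed
  finally have "has_bochner_integral lborel
      (\<lambda>y. Re (complex_of_real (exp (- pi * u * (norm y)\<^sup>2)) * iexp (2 * pi * (x \<bullet> y))))
      (Re (complex_of_real (u powr (- real DIM('a) / 2) * exp (- pi * (norm x)\<^sup>2 / u))))"
    using has_bochner_integral_bounded_linear[OF bounded_linear_Re] by blast
  then show ?thesis by (simp add: Re_exp)
qed

section \<open>Polynomials times Gaussians\<close>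

lemma power_times_exp_le:
  fixes t u :: real
  assumes "t \<ge> 0" "u > 0"
  shows "t ^ k * exp (- (u * t)) \<le> fact k / u ^ k"
proof -
  have "(u * t) ^ k / fact k \<le> exp (u * t)"
  proof -
    have "(\<Sum>i\<in>{k}. (u * t) ^ i /\<^sub>R fact i) \<le> (\<Sum>i. (u * t) ^ i /\<^sub>R fact i)"
      using assms by (intro sum_le_suminf summable_exp_generic) auto
    then show ?thesis by (simp add: exp_def divide_inverse mult.commute)
  qed
  then show ?thesis
    using assms by (simp add: exp_minus field_simps power_mult_distrib)
qed

lemma abs_exp_minus_Taylor_le:
  fixes z :: real
  shows "\<bar>exp z - 1 - z\<bar> \<le> z\<^sup>2 * exp \<bar>z\<bar>"
proof -
  have 1: "1 + z \<le> exp z" "1 - z \<le> exp (- z)"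
    using exp_ge_add_one_self[of z] exp_ge_add_one_self[of "- z"] by auto
  have "(1 - z) * exp z \<le> exp (- z) * exp z"
    using 1 by (intro mult_right_mono) auto
  then have 2: "exp z - 1 \<le> z * exp z" by (simp add: exp_minus algebra_simps)
  have "exp z - 1 - z \<le> z * (exp z - 1)" using 2 by (simp add: algebra_simps)
  also have "\<dots> \<le> z\<^sup>2 * exp \<bar>z\<bar>"
  proof (cases "z \<ge> 0")
    case True
    then show ?thesis using mult_left_mono[OF 2 True] by (simp add: power2_eq_square mult.assoc)
  next
    case False
    have "z * (exp z - 1) \<le> z * z" using 1 False by (intro mult_left_mono_neg) linarith+
    also have "\<dots> \<le> z * z * exp \<bar>z\<bar>"
      using mult_left_mono[of 1 "exp \<bar>z\<bar>" "z * z"] by simp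
    finally show ?thesis by (simp add: power2_eq_square)
  qed
  finally have "exp z - 1 - z \<le> z\<^sup>2 * exp \<bar>z\<bar>" .
  moreover have "0 \<le> exp z - 1 - z" using 1(1) by linarith
  ultimately show ?thesis by (simp only: abs_of_nonneg)
qed

text \<open>
  Differentiation under the integral sign for \<open>u \<mapsto> \<integral> q ^ k * exp (- u * q) * c\<close>. The second-order
  Taylor remainder of the exponential gives an error of at most \<open>h\<^sup>2 * K\<close> with
  \<open>K = \<integral> q ^ (k + 2) * exp (- u * q / 2)\<close>, so no dominated convergence is needed.
\<close>

lemma
  fixes q c :: "'a \<Rightarrow> real"
  assumes meas [measurable]: "q \<in> borel_measurable M" "c \<in> borel_measurable M"
    and q: "\<And>y. q y \<ge> 0" and c: "\<And>y. \<bar>c y\<bar> \<le> 1"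
    and int: "\<And>u. u > 0 \<Longrightarrow> integrable M (\<lambda>y. exp (- (u * q y)))"
  shows integrable_power_times_exp:
      "u > 0 \<Longrightarrow> integrable M (\<lambda>y. q y ^ k * exp (- (u * q y)) * c y)"
    and integral_power_times_exp_deriv:
      "u > 0 \<Longrightarrow> ((\<lambda>u. \<integral>y. q y ^ k * exp (- (u * q y)) * c y \<partial>M)
         has_real_derivative - (\<integral>y. q y ^ Suc k * exp (- (u * q y)) * c y \<partial>M)) (at u)"
proof -
  have *: "q y ^ k * exp (- (u * q y)) * \<bar>c y\<bar> \<le> fact k / (u / 2) ^ k * exp (- (u / 2 * q y))"
    if "u > 0" for u y k
  proof -
    have "q y ^ k * exp (- (u * q y)) * \<bar>c y\<bar> \<le> (q y ^ k * exp (- (u / 2 * q y))) * exp (- (u / 2 * q y))"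
      using c[of y] q[of y] by (auto simp: mult.assoc mult_exp_exp intro!: mult_left_mono mult_left_le)
    also have "\<dots> \<le> fact k / (u / 2) ^ k * exp (- (u / 2 * q y))"
      using that q[of y] by (intro mult_right_mono power_times_exp_le) auto
    finally show ?thesis .
  qed
  have integrable: "integrable M (\<lambda>y. q y ^ k * exp (- (u * q y)) * c y)" if "u > 0" for u k
  proof (rule Bochner_Integration.integrable_bound)
    show "integrable M (\<lambda>y. fact k / (u / 2) ^ k * exp (- (u / 2 * q y)))"
      using int[of "u / 2"] that by (intro integrable_mult_right) auto
    show "AE y in M. norm (q y ^ k * exp (- (u * q y)) * c y)
        \<le> norm (fact k / (u / 2) ^ k * exp (- (u / 2 * q y)))"
      using *[OF that] q that by (auto simp: abs_mult intro!: AE_I2)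
  qed measurable
  then show "u > 0 \<Longrightarrow> integrable M (\<lambda>y. q y ^ k * exp (- (u * q y)) * c y)" .
  assume u: "u > 0"
  let ?I = "\<lambda>k u. \<integral>y. q y ^ k * exp (- (u * q y)) * c y \<partial>M"
  define K where "K = (\<integral>y. q y ^ (k + 2) * exp (- (u / 2 * q y)) * 1 \<partial>M)"
  have bound: "\<bar>?I k (u + h) - ?I k u + h * ?I (Suc k) u\<bar> \<le> h\<^sup>2 * K" if h: "\<bar>h\<bar> \<le> u / 2" for h
  proof -
    have uh: "u + h > 0" using u h by linarith
    have iK: "integrable M (\<lambda>y. q y ^ (k + 2) * exp (- (u / 2 * q y)) * 1)"
    proof -
      have "integrable M (\<lambda>y. fact (k+2) / (u / 4) ^ (k+2) * exp (- (u / 4 * q y)))"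
        using int[of "u / 4"] u by (intro integrable_mult_right) auto
      then show ?thesis
      proof (rule Bochner_Integration.integrable_bound)
        have "q y ^ (k + 2) * exp (- (u / 2 * q y)) \<le> fact (k+2) / (u / 4) ^ (k+2) * exp (- (u / 4 * q y))" for y
        proof -
          have "q y ^ (k + 2) * exp (- (u / 2 * q y)) = (q y ^ (k + 2) * exp (- (u / 4 * q y))) * exp (- (u / 4 * q y))"
            by (simp add: mult.assoc mult_exp_exp)
          also have "\<dots> \<le> fact (k+2) / (u / 4) ^ (k+2) * exp (- (u / 4 * q y))"
            using u q[of y] by (intro mult_right_mono power_times_exp_le) auto
          finally show ?thesis .
        qed
        then show "AE y in M. norm (q y ^ (k + 2) * exp (- (u / 2 * q y)) * 1)
            \<le> norm (fact (k + 2) / (u / 4) ^ (k + 2) * exp (- (u / 4 * q y)))"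
          using q u by (auto simp: abs_mult intro!: AE_I2)
      qed measurable
    qed
    have "\<bar>?I k (u + h) - ?I k u + h * ?I (Suc k) u\<bar>
        = \<bar>\<integral>y. q y ^ k * exp (- ((u + h) * q y)) * c y - q y ^ k * exp (- (u * q y)) * c y
              + h * (q y ^ Suc k * exp (- (u * q y)) * c y) \<partial>M\<bar>"
      using integrable[OF uh] integrable[OF u] integrable[OF u, of "Suc k"] by simp
    also have "\<dots> \<le> (\<integral>y. h\<^sup>2 * (q y ^ (k + 2) * exp (- (u / 2 * q y)) * 1) \<partial>M)"
    proof (rule order_trans[OF integral_abs_bound] , rule integral_mono')
      show "integrable M (\<lambda>y. h\<^sup>2 * (q y ^ (k + 2) * exp (- (u / 2 * q y)) * 1))"
        using iK by (rule integrable_mult_right)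
      fix y
      have "q y ^ k * exp (- ((u + h) * q y)) * c y - q y ^ k * exp (- (u * q y)) * c y
              + h * (q y ^ Suc k * exp (- (u * q y)) * c y)
          = q y ^ k * exp (- (u * q y)) * c y * (exp (- (h * q y)) - 1 - (- (h * q y)))"
      proof -
        have "exp (- ((u + h) * q y)) = exp (- (u * q y)) * exp (- (h * q y))"
          by (simp add: mult_exp_exp algebra_simps)
        then show ?thesis by (simp only:) (simp add: algebra_simps)
      qed
      also have "\<bar>\<dots>\<bar> = q y ^ k * exp (- (u * q y)) * \<bar>c y\<bar> * \<bar>exp (- (h * q y)) - 1 - (- (h * q y))\<bar>"
        using q[of y] by (simp add: abs_mult)
      also have "\<dots> \<le> q y ^ k * exp (- (u * q y)) * 1 * ((- (h * q y))\<^sup>2 * exp \<bar>- (h * q y)\<bar>)"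
        using q[of y] c[of y] by (intro mult_mono abs_exp_minus_Taylor_le mult_nonneg_nonneg order_refl) auto
      also have "\<dots> = h\<^sup>2 * q y ^ (k + 2) * (exp (- (u * q y)) * exp (\<bar>h\<bar> * q y))"
        using q[of y] by (simp add: abs_mult power2_eq_square mult_ac)
      also have "\<dots> = h\<^sup>2 * q y ^ (k + 2) * exp (- ((u - \<bar>h\<bar>) * q y))"
        by (simp add: mult_exp_exp algebra_simps)
      also have "\<dots> \<le> h\<^sup>2 * q y ^ (k + 2) * exp (- (u / 2 * q y))"
      proof (rule mult_left_mono)
        have "u / 2 * q y \<le> (u - \<bar>h\<bar>) * q y"
          using h q[of y] by (intro mult_right_mono) auto
        then show "exp (- ((u - \<bar>h\<bar>) * q y)) \<le> exp (- (u / 2 * q y))"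
          by (simp only: exp_le_cancel_iff neg_le_iff_le)
        show "0 \<le> h\<^sup>2 * q y ^ (k + 2)" using q[of y] by simp
      qed
      finally show "\<bar>q y ^ k * exp (- ((u + h) * q y)) * c y - q y ^ k * exp (- (u * q y)) * c y
              + h * (q y ^ Suc k * exp (- (u * q y)) * c y)\<bar> \<le> h\<^sup>2 * (q y ^ (k + 2) * exp (- (u / 2 * q y)) * 1)"
        by (simp add: mult.assoc)
    qed (use q in auto)
    also have "(\<integral>y. h\<^sup>2 * (q y ^ (k + 2) * exp (- (u / 2 * q y)) * 1) \<partial>M) = h\<^sup>2 * K"
      unfolding K_def by (rule integral_mult_right_zero)
    finally show ?thesis .
  qed
  show "((\<lambda>u. ?I k u) has_real_derivative - ?I (Suc k) u) (at u)"
    unfolding DERIV_def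
  proof -
    have "\<forall>\<^sub>F h in at 0. norm ((?I k (u + h) - ?I k u) / h - - ?I (Suc k) u) \<le> \<bar>h\<bar> * K"
    proof -
      have "\<forall>\<^sub>F h in at 0. \<bar>h\<bar> < u / 2 \<and> h \<noteq> 0"
        using u by (auto simp: eventually_at dist_real_def intro!: exI[of _ "u / 2"])
      then show ?thesis
      proof eventually_elim
        case (elim h)
        have "(?I k (u + h) - ?I k u) / h - - ?I (Suc k) u = (?I k (u + h) - ?I k u + h * ?I (Suc k) u) / h"
          using elim by (simp add: field_simps)
        also have "\<bar>\<dots>\<bar> \<le> h\<^sup>2 * K / \<bar>h\<bar>"
          using bound[of h] elim by (simp add: divide_right_mono)
        also have "\<dots> = \<bar>h\<bar> * K"
          using elim by (simp add: power2_eq_square abs_if)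
        finally show ?case by simp
      qed
    qed
    moreover have "((\<lambda>h. \<bar>h\<bar> * K) \<longlongrightarrow> 0) (at 0)"
      by (auto intro!: tendsto_eq_intros)
    ultimately have "((\<lambda>h. (?I k (u + h) - ?I k u) / h - - ?I (Suc k) u) \<longlongrightarrow> 0) (at 0)"
      by (rule Lim_null_comparison)
    then show "(\<lambda>h. (?I k (u + h) - ?I k u) / h) \<midarrow>0\<rightarrow> - ?I (Suc k) u"
      by (simp only: LIM_zero_iff)
  qed
qed

text \<open>
  The integrals \<open>\<integral> (pi * |y|\<^sup>2) ^ k * exp (- u * pi * |y|\<^sup>2) * cos (2 * pi * (x \<bullet> y)) dy\<close> over
  \<open>n\<close>-dimensional space are polynomials in \<open>t = pi * |x|\<^sup>2\<close> times \<open>exp (- t / u)\<close> and a power of \<open>u\<close>. With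
  \<open>m = n / 2\<close>, the coefficient of \<open>t ^ j\<close> is \<open>gauss_coeff m k j\<close>: up to the factor \<open>fact k\<close> it is the coefficient of the
  generalised Laguerre polynomial of degree \<open>k\<close> and parameter \<open>m - 1\<close>. The whole closed form is
  \<open>gauss_moment m k t u\<close>; it is justified by \<open>gauss_integral\<close> below.
\<close>

definition gauss_coeff :: "real \<Rightarrow> nat \<Rightarrow> nat \<Rightarrow> real" where
  "gauss_coeff m k j = (-1) ^ j * real (k choose j) * (pochhammer m k / pochhammer m j)"

lemma gauss_coeff_Suc:
  assumes "m > 0"
  shows "gauss_coeff m (Suc k) 0 = (m + k) * gauss_coeff m k 0"
    "gauss_coeff m (Suc k) (Suc j) = (m + k + Suc j) * gauss_coeff m k (Suc j) - gauss_coeff m k j"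
proof -
  have pos: "pochhammer m i > 0" for i using assms by (rule pochhammer_pos)
  show "gauss_coeff m (Suc k) 0 = (m + k) * gauss_coeff m k 0"
    by (simp add: gauss_coeff_def pochhammer_rec')
  have b: "real (Suc j) * real (k choose Suc j) = (real k - real j) * real (k choose j)"
  proof (cases "j \<le> k")
    case True
    have "Suc j * (k choose Suc j) = (k - j) * (k choose j)"
      by (simp only: binomial_absorb_comp binomial_absorption)
    then show ?thesis using True by (metis of_nat_mult of_nat_diff)
  qed (simp add: binomial_eq_0)
  have m: "m + real j > 0" using assms by simp
  have "(m + k + Suc j) * real (k choose Suc j) + (m + j) * real (k choose j)
      = (m + k) * (real (k choose Suc j) + real (k choose j)) + (real (Suc j) * real (k choose Suc j) - (real k - real j) * real (k choose j))"
    by (simp add: algebra_simps)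
  also have "\<dots> = (m + k) * real (Suc k choose Suc j)"
    unfolding b by simp
  finally have e: "(m + k + Suc j) * real (k choose Suc j) + (m + j) * real (k choose j) = (m + k) * real (Suc k choose Suc j)" .
  have "gauss_coeff m (Suc k) (Suc j) = (-1) ^ Suc j * ((m + k) * real (Suc k choose Suc j)) * (pochhammer m k / pochhammer m (Suc j))"
    by (simp add: gauss_coeff_def pochhammer_rec'[of m k] mult_ac)
  also have "\<dots> = (m + k + Suc j) * gauss_coeff m k (Suc j)
      + (-1) ^ Suc j * real (k choose j) * ((m + j) * (pochhammer m k / pochhammer m (Suc j)))"
    unfolding e[symmetric] gauss_coeff_def by algebra
  also have "(m + j) * (pochhammer m k / pochhammer m (Suc j)) = pochhammer m k / pochhammer m j"
    using m pos[of j] by (simp add: pochhammer_rec'[of m j])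
  finally show "gauss_coeff m (Suc k) (Suc j) = (m + k + Suc j) * gauss_coeff m k (Suc j) - gauss_coeff m k j"
    by (simp add: gauss_coeff_def)
qed

text \<open>
  The parameter \<open>u\<close> is kept because the closed form is found by differentiating the case \<open>k = 0\<close> repeatedly
  with respect to \<open>u\<close>.
\<close>

definition gauss_moment :: "real \<Rightarrow> nat \<Rightarrow> real \<Rightarrow> real \<Rightarrow> real" where
  "gauss_moment m k t u = (\<Sum>j\<le>k. gauss_coeff m k j * t ^ j * u powr (- m - k - j)) * exp (- (t / u))"

lemma gauss_moment_deriv:
  assumes "m > 0" "u > 0"
  shows "(gauss_moment m k t has_real_derivative - gauss_moment m (Suc k) t u) (at u)"
proof -
  define E where "E j = t ^ j * u powr (- m - real (Suc k) - real j)" for j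
  define S where "S = (\<Sum>j\<le>k. gauss_coeff m k j * t ^ j * u powr (- m - k - j))"
  have t: "gauss_coeff m k j * t ^ j * ((- m - k - j) * u powr (- m - k - j - 1))
      + gauss_coeff m k j * t ^ j * u powr (- m - k - j) * (t / u\<^sup>2)
      = - ((m + k + j) * gauss_coeff m k j * E j - gauss_coeff m k j * E (Suc j))" for j
  proof -
    have "u powr (- m - k - j) / u\<^sup>2 = u powr (- m - real (Suc k) - real (Suc j))"
    proof -
      have "- m - real (Suc k) - real (Suc j) = (- m - k - j) - 2" by simp
      then show ?thesis
        using assms by (simp only: powr_diff[of u _ 2]) simp
    qed
    then have X: "t ^ Suc j * (u powr (- m - k - j) / u\<^sup>2) = E (Suc j)"
      by (simp only: E_def)
    have "gauss_coeff m k j * t ^ j * u powr (- m - k - j) * (t / u\<^sup>2) = gauss_coeff m k j * E (Suc j)"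
      unfolding X[symmetric] by (simp only: divide_inverse power_Suc mult_ac)
    moreover have "gauss_coeff m k j * t ^ j * ((- m - k - j) * u powr (- m - k - j - 1))
        = - ((m + k + j) * gauss_coeff m k j * E j)"
    proof -
      have "- m - k - j - 1 = - m - real (Suc k) - real j" by simp
      then have X: "t ^ j * u powr (- m - k - j - 1) = E j" by (simp only: E_def)
      have "c * T * (w * z) = - (v * c * (T * z))" if "w = - v" for c T w z v :: real
        using that by simp
      from this[of "- m - k - j" "m + k + j"] show ?thesis unfolding X[symmetric] by simp
    qed
    ultimately show ?thesis by simp
  qed
  have "(gauss_moment m k t has_real_derivative
      (\<Sum>j\<le>k. gauss_coeff m k j * t ^ j * ((- m - k - j) * u powr (- m - k - j - 1))) * exp (- (t / u))
      + exp (- (t / u)) * (t / u\<^sup>2) * S) (at u)"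
  proof -
    have 1: "((\<lambda>u. \<Sum>j\<le>k. gauss_coeff m k j * t ^ j * u powr (- m - k - j)) has_real_derivative
        (\<Sum>j\<le>k. gauss_coeff m k j * t ^ j * ((- m - k - j) * u powr (- m - k - j - 1)))) (at u)"
      using assms by (intro DERIV_sum DERIV_cmult has_real_derivative_powr)
    have 2: "((\<lambda>u. exp (- (t / u))) has_real_derivative exp (- (t / u)) * (t / u\<^sup>2)) (at u)"
      using assms by (auto intro!: derivative_eq_intros simp: power2_eq_square)
    from DERIV_mult'[OF 1 2] show ?thesis
      unfolding gauss_moment_def[abs_def] S_def by (simp only: mult.commute add.commute)
  qed
  also have "(\<Sum>j\<le>k. gauss_coeff m k j * t ^ j * ((- m - k - j) * u powr (- m - k - j - 1))) * exp (- (t / u))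
      + exp (- (t / u)) * (t / u\<^sup>2) * S
      = (\<Sum>j\<le>k. gauss_coeff m k j * t ^ j * ((- m - k - j) * u powr (- m - k - j - 1))
           + gauss_coeff m k j * t ^ j * u powr (- m - k - j) * (t / u\<^sup>2)) * exp (- (t / u))"
    by (simp only: sum.distrib sum_distrib_right[symmetric] S_def[symmetric]) (simp only: distrib_left mult_ac)
  also have "\<dots> = - (\<Sum>j\<le>k. (m + k + j) * gauss_coeff m k j * E j - gauss_coeff m k j * E (Suc j)) * exp (- (t / u))"
    unfolding t by (simp only: sum_negf mult_minus_left)
  also have "(\<Sum>j\<le>k. (m + k + j) * gauss_coeff m k j * E j - gauss_coeff m k j * E (Suc j))
      = (\<Sum>j\<le>Suc k. gauss_coeff m (Suc k) j * E j)"
  proof -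
    have z: "gauss_coeff m k (Suc k) = 0" by (simp add: gauss_coeff_def)
    have "(\<Sum>j\<le>Suc k. gauss_coeff m (Suc k) j * E j)
        = (m + k) * gauss_coeff m k 0 * E 0 + (\<Sum>j\<le>k. ((m + k + Suc j) * gauss_coeff m k (Suc j) - gauss_coeff m k j) * E (Suc j))"
      by (simp only: sum.atMost_Suc_shift gauss_coeff_Suc[OF assms(1)])
    also have "\<dots> = ((m + k) * gauss_coeff m k 0 * E 0 + (\<Sum>j\<le>k. (m + k + Suc j) * gauss_coeff m k (Suc j) * E (Suc j)))
          - (\<Sum>j\<le>k. gauss_coeff m k j * E (Suc j))"
      by (simp add: left_diff_distrib sum_subtractf)
    also have "(m + k) * gauss_coeff m k 0 * E 0 + (\<Sum>j\<le>k. (m + k + Suc j) * gauss_coeff m k (Suc j) * E (Suc j))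
        = (\<Sum>j\<le>Suc k. (m + k + j) * gauss_coeff m k j * E j)"
      by (subst sum.atMost_Suc_shift) simp
    also have "\<dots> = (\<Sum>j\<le>k. (m + k + j) * gauss_coeff m k j * E j)" by (simp add: z)
    finally show ?thesis by (simp add: sum_subtractf)
  qed
  also have "- (\<Sum>j\<le>Suc k. gauss_coeff m (Suc k) j * E j) * exp (- (t / u)) = - gauss_moment m (Suc k) t u"
    by (simp only: gauss_moment_def E_def mult.assoc mult_minus_left)
  finally show ?thesis .
qed

lemma gauss_integrable:
  fixes x :: "'a::euclidean_space"
  assumes "u > 0"
  shows "integrable lborel (\<lambda>y. (pi * (norm y)\<^sup>2) ^ k * exp (- (u * (pi * (norm y)\<^sup>2))) * cos (2 * pi * (x \<bullet> y)))"
proof (rule integrable_power_times_exp)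
  fix u :: real assume "u > 0"
  from fourier_gaussian[OF this, of "0::'a"] show "integrable lborel (\<lambda>y::'a. exp (- (u * (pi * (norm y)\<^sup>2))))"
    by (simp add: has_bochner_integral_iff mult_ac)
qed (use assms in auto)

lemma gauss_integral:
  fixes x :: "'a::euclidean_space"
  assumes "u > 0"
  shows "(\<integral>y. (pi * (norm y)\<^sup>2) ^ k * exp (- (u * (pi * (norm y)\<^sup>2))) * cos (2 * pi * (x \<bullet> y)) \<partial>lborel)
    = gauss_moment (real DIM('a) / 2) k (pi * (norm x)\<^sup>2) u"
  using assms
proof (induction k arbitrary: u)
  case 0
  from fourier_gaussian[OF this, of x] show ?case
    by (simp add: has_bochner_integral_iff gauss_moment_def gauss_coeff_def mult_ac)
next
  case (Suc k)
  let ?I = "\<lambda>k u. \<integral>y. (pi * (norm y)\<^sup>2) ^ k * exp (- (u * (pi * (norm y)\<^sup>2))) * cos (2 * pi * (x \<bullet> y)) \<partial>lborel"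
  have "(?I k has_real_derivative - ?I (Suc k) u) (at u)"
  proof (rule integral_power_times_exp_deriv)
    fix u :: real assume "u > 0"
    from fourier_gaussian[OF this, of "0::'a"] show "integrable lborel (\<lambda>y::'a. exp (- (u * (pi * (norm y)\<^sup>2))))"
      by (simp add: has_bochner_integral_iff mult_ac)
  qed (use Suc.prems in auto)
  moreover have "(?I k has_real_derivative - gauss_moment (real DIM('a) / 2) (Suc k) (pi * (norm x)\<^sup>2) u) (at u)"
  proof (subst DERIV_cong_ev[OF refl _ refl])
    show "(gauss_moment (real DIM('a) / 2) k (pi * (norm x)\<^sup>2) has_real_derivative
       - gauss_moment (real DIM('a) / 2) (Suc k) (pi * (norm x)\<^sup>2) u) (at u)"
      using Suc.prems by (intro gauss_moment_deriv) auto
    have "\<forall>\<^sub>F v in nhds u. v \<in> {0<..}"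
      using Suc.prems by (intro eventually_nhds_in_open) auto
    then show "\<forall>\<^sub>F v in nhds u. ?I k v = gauss_moment (real DIM('a) / 2) k (pi * (norm x)\<^sup>2) v"
      by eventually_elim (use Suc.IH in auto)
  qed
  ultimately show ?case using DERIV_unique by fastforce
qed

text \<open>
  Comparison of coefficients in \<open>\<Sum> a k * x ^ k = \<Sum> b k * (1 - x) ^ k\<close>.
\<close>

lemma coeffs_reflect:
  fixes a b :: "nat \<Rightarrow> real"
  assumes "\<And>x. (\<Sum>k\<le>d. a k * x ^ k) = (\<Sum>k\<le>d. b k * (1 - x) ^ k)" and "j \<le> d"
  shows "a j = (\<Sum>k\<le>d. (-1) ^ j * real (k choose j) * b k)"
proof -
  have bin: "(1 - x) ^ k = (\<Sum>j\<le>d. (-1) ^ j * real (k choose j) * x ^ j)" if "k \<le> d" for x :: real and k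
  proof -
    have "(1 - x) ^ k = (- x + 1) ^ k" by simp
    also have "\<dots> = (\<Sum>j\<le>k. real (k choose j) * (- x) ^ j)"
      by (subst binomial_ring) simp
    also have "\<dots> = (\<Sum>j\<le>d. real (k choose j) * (- x) ^ j)"
      using that by (intro sum.mono_neutral_left) (auto simp: binomial_eq_0)
    also have "\<dots> = (\<Sum>j\<le>d. (-1) ^ j * real (k choose j) * x ^ j)"
      by (intro sum.cong refl) (subst power_minus, simp)
    finally show ?thesis .
  qed
  have "(\<Sum>k\<le>d. a k * x ^ k) = (\<Sum>j\<le>d. (\<Sum>k\<le>d. (-1) ^ j * real (k choose j) * b k) * x ^ j)" for x
  proof -
    have "(\<Sum>k\<le>d. a k * x ^ k) = (\<Sum>k\<le>d. \<Sum>j\<le>d. b k * ((-1) ^ j * real (k choose j) * x ^ j))"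
      unfolding assms(1) by (intro sum.cong refl) (simp add: bin sum_distrib_left)
    also have "\<dots> = (\<Sum>j\<le>d. \<Sum>k\<le>d. b k * ((-1) ^ j * real (k choose j) * x ^ j))"
      by (rule sum.swap)
    also have "\<dots> = (\<Sum>j\<le>d. (\<Sum>k\<le>d. (-1) ^ j * real (k choose j) * b k) * x ^ j)"
      by (simp add: sum_distrib_right sum_distrib_left mult_ac)
    finally show ?thesis .
  qed
  then have "\<forall>j\<le>d. a j = (\<Sum>k\<le>d. (-1) ^ j * real (k choose j) * b k)"
    using polyfun_eq_coeffs[of a d "\<lambda>j. \<Sum>k\<le>d. (-1) ^ j * real (k choose j) * b k"] by blast
  then show ?thesis using assms(2) by blast
qed

text \<open>
  The Fourier transform on polynomials in \<open>pi * |x|\<^sup>2\<close> times a Gaussian. After the coefficient of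
  index \<open>k\<close> has been multiplied by \<open>pochhammer m k\<close>, it is the substitution \<open>x \<mapsto> 1 - x\<close>, by the shape of the
  coefficients \<open>gauss_coeff m k j\<close>. In this form the transform is visibly an involution, and the hypothesis
  \<open>reflect\<close> says that \<open>p\<close> and \<open>g\<close> are transforms of each other.
\<close>

context
  fixes p g :: "nat \<Rightarrow> real" and d :: nat and m u :: real
  assumes reflect: "\<And>x. (\<Sum>k\<le>d. g k * pochhammer m k * x ^ k) = (\<Sum>k\<le>d. p k * pochhammer m k * (1 - x) ^ k)"
    and m: "m = real DIM('a::euclidean_space) / 2" and u: "u > 0"
begin

lemma gaussian_poly_transform_integrable:
  "integrable lborel (\<lambda>y::'a. u powr m * ((\<Sum>k\<le>d. g k * (u * (pi * (norm y)\<^sup>2)) ^ k) * exp (- (u * (pi * (norm y)\<^sup>2)))))"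
  using gauss_integrable[OF u, of _ "0::'a"]
  by (intro integrable_mult_right)
     (simp add: sum_distrib_right power_mult_distrib mult.assoc)

lemma gaussian_poly_transform:
  fixes x :: 'a
  shows "(\<Sum>k\<le>d. p k * (pi * (norm x)\<^sup>2 / u) ^ k) * exp (- (pi * (norm x)\<^sup>2 / u))
    = (\<integral>y. (u powr m * ((\<Sum>k\<le>d. g k * (u * (pi * (norm y)\<^sup>2)) ^ k) * exp (- (u * (pi * (norm y)\<^sup>2)))))
          * cos (2 * pi * (x \<bullet> y)) \<partial>lborel)"
proof -
  define t where "t = pi * (norm x)\<^sup>2"
  have m0: "m > 0" unfolding m by simp
  have "(\<integral>y. (u powr m * ((\<Sum>k\<le>d. g k * (u * (pi * (norm y)\<^sup>2)) ^ k) * exp (- (u * (pi * (norm y)\<^sup>2)))))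
          * cos (2 * pi * (x \<bullet> y)) \<partial>lborel)
      = (\<integral>y. (\<Sum>k\<le>d. u powr m * g k * u ^ k *
          ((pi * (norm y)\<^sup>2) ^ k * exp (- (u * (pi * (norm y)\<^sup>2))) * cos (2 * pi * (x \<bullet> y)))) \<partial>lborel)"
    by (intro Bochner_Integration.integral_cong refl)
       (simp only: sum_distrib_right sum_distrib_left power_mult_distrib mult.assoc)
  also have "\<dots> = (\<Sum>k\<le>d. u powr m * g k * u ^ k * gauss_moment m k t u)"
    by (subst Bochner_Integration.integral_sum)
       (auto intro!: integrable_mult_right gauss_integrable u simp: gauss_integral[OF u] m t_def)
  also have "\<dots> = (\<Sum>k\<le>d. \<Sum>j\<le>d. g k * gauss_coeff m k j * (t / u) ^ j * exp (- (t / u)))"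
  proof (rule sum.cong[OF refl])
    fix k assume k: "k \<in> {..d}"
    have "u powr m * g k * u ^ k * gauss_moment m k t u
        = (\<Sum>j\<le>k. g k * gauss_coeff m k j * (t ^ j * (u powr m * u ^ k * u powr (- m - k - j))) * exp (- (t / u)))"
      unfolding gauss_moment_def by (simp only: sum_distrib_right sum_distrib_left mult_ac)
    also have "\<dots> = (\<Sum>j\<le>k. g k * gauss_coeff m k j * (t / u) ^ j * exp (- (t / u)))"
    proof (rule sum.cong[OF refl])
      fix j :: nat
      have "u powr m * u ^ k * u powr (- m - k - j) = u powr (m + k + (- m - k - j))"
        using u by (simp only: powr_add powr_realpow)
      also have "m + k + (- m - k - j) = - real j" by simp
      also have "u powr (- real j) = 1 / u ^ j"
        using u by (simp only: powr_minus_divide powr_realpow)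
      finally show "g k * gauss_coeff m k j * (t ^ j * (u powr m * u ^ k * u powr (- m - k - j))) * exp (- (t / u))
          = g k * gauss_coeff m k j * (t / u) ^ j * exp (- (t / u))"
        by (simp only: power_divide times_divide_eq_right mult_1_right)
    qed
    also have "\<dots> = (\<Sum>j\<le>d. g k * gauss_coeff m k j * (t / u) ^ j * exp (- (t / u)))"
      using k by (intro sum.mono_neutral_left) (auto simp: gauss_coeff_def binomial_eq_0)
    finally show "u powr m * g k * u ^ k * gauss_moment m k t u
        = (\<Sum>j\<le>d. g k * gauss_coeff m k j * (t / u) ^ j * exp (- (t / u)))" .
  qed
  also have "\<dots> = (\<Sum>j\<le>d. (\<Sum>k\<le>d. g k * gauss_coeff m k j) * ((t / u) ^ j * exp (- (t / u))))"
    by (subst sum.swap) (simp only: sum_distrib_right mult.assoc)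
  also have "\<dots> = (\<Sum>j\<le>d. p j * ((t / u) ^ j * exp (- (t / u))))"
  proof (rule sum.cong[OF refl])
    fix j assume j: "j \<in> {..d}"
    have "(\<Sum>k\<le>d. p k * pochhammer m k * x ^ k) = (\<Sum>k\<le>d. g k * pochhammer m k * (1 - x) ^ k)" for x
      using reflect[of "1 - x"] by simp
    from coeffs_reflect[OF this, of j] j
    have "p j * pochhammer m j = (\<Sum>k\<le>d. (-1) ^ j * real (k choose j) * (g k * pochhammer m k))"
      by simp
    also have "\<dots> = (\<Sum>k\<le>d. g k * gauss_coeff m k j * pochhammer m j)"
      using pochhammer_pos[OF m0, of j] by (intro sum.cong refl) (simp add: gauss_coeff_def)
    also have "\<dots> = (\<Sum>k\<le>d. g k * gauss_coeff m k j) * pochhammer m j"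
      by (simp only: sum_distrib_right)
    finally have "p j * pochhammer m j = (\<Sum>k\<le>d. g k * gauss_coeff m k j) * pochhammer m j" .
    then have "p j = (\<Sum>k\<le>d. g k * gauss_coeff m k j)"
      using pochhammer_pos[OF m0, of j] by simp
    then show "(\<Sum>k\<le>d. g k * gauss_coeff m k j) * ((t / u) ^ j * exp (- (t / u))) = p j * ((t / u) ^ j * exp (- (t / u)))"
      by simp
  qed
  finally show ?thesis
    by (simp only: sum_distrib_right mult.assoc t_def)
qed

lemma gaussian_poly_integral:
  "has_bochner_integral lborel
     (\<lambda>x::'a. (\<Sum>k\<le>d. p k * (pi * (norm x)\<^sup>2 / u) ^ k) * exp (- (pi * (norm x)\<^sup>2 / u)))
     (u powr m * g 0)"
proof -
  have u': "1 / u > 0" using u by simp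
  let ?h = "\<lambda>k (y::'a). (pi * (norm y)\<^sup>2) ^ k * exp (- (1 / u * (pi * (norm y)\<^sup>2)))"
  have int: "integrable lborel (?h k)" for k
    using gauss_integrable[OF u', of k "0::'a"] by simp
  have val: "integral\<^sup>L lborel (?h k) = pochhammer m k * u powr m * u ^ k" for k
  proof -
    have "integral\<^sup>L lborel (?h k) = gauss_moment m k 0 (1 / u)"
      using gauss_integral[OF u', of k "0::'a"] by (simp add: m)
    also have "\<dots> = gauss_coeff m k 0 * (1 / u) powr (- m - k)"
      by (simp add: gauss_moment_def power_0_left if_distrib[where f="\<lambda>x. x * _"] if_distrib[where f="\<lambda>x. _ * x"] sum.delta' cong: if_cong)
    also have "(1 / u) powr (- m - k) = u powr (m + k)"
      using u by (simp add: powr_minus_divide powr_divide powr_diff powr_add)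
    also have "\<dots> = u powr m * u ^ k" using u by (simp only: powr_add powr_realpow)
    finally show ?thesis by (simp add: gauss_coeff_def)
  qed
  have "has_bochner_integral lborel (\<lambda>x. \<Sum>k\<le>d. p k / u ^ k * ?h k x)
          (\<Sum>k\<le>d. p k / u ^ k * (pochhammer m k * u powr m * u ^ k))"
    using int val
    by (intro has_bochner_integral_sum has_bochner_integral_mult_right) (simp add: has_bochner_integral_iff)
  also have "(\<lambda>x. \<Sum>k\<le>d. p k / u ^ k * ?h k x)
      = (\<lambda>x. (\<Sum>k\<le>d. p k * (pi * (norm x)\<^sup>2 / u) ^ k) * exp (- (pi * (norm x)\<^sup>2 / u)))"
    by (simp add: sum_distrib_right power_divide mult.assoc)
  also have "(\<Sum>k\<le>d. p k / u ^ k * (pochhammer m k * u powr m * u ^ k)) = u powr m * (\<Sum>k\<le>d. p k * pochhammer m k)"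
    using u by (simp add: sum_distrib_left mult_ac)
  also have "(\<Sum>k\<le>d. p k * pochhammer m k) = g 0"
  proof -
    have "(\<Sum>k\<le>d. g k * pochhammer m k * 0 ^ k) = g 0"
      by (subst sum.remove[of _ 0]) auto
    then show ?thesis using reflect[of 0] by simp
  qed
  finally show ?thesis .
qed

end

section \<open>Positive definiteness and the linear programming bound\<close>

lemma (in finite_measure) integral_mult_integral_swap:
  fixes G :: "'b \<Rightarrow> real" and h :: "'b \<Rightarrow> 'a \<Rightarrow> real"
  assumes N: "sigma_finite_measure N"
    and G: "integrable N G"
    and h [measurable]: "(\<lambda>(x, y). h x y) \<in> borel_measurable (N \<Otimes>\<^sub>M M)"
    and bound: "\<And>x y. \<bar>h x y\<bar> \<le> B"
  shows "integrable N (\<lambda>x. G x * (\<integral>y. h x y \<partial>M))"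
    and "(\<integral>x. G x * (\<integral>y. h x y \<partial>M) \<partial>N) = (\<integral>y. (\<integral>x. G x * h x y \<partial>N) \<partial>M)"
proof -
  interpret N: sigma_finite_measure N by fact
  interpret pair_sigma_finite N M ..
  have [measurable]: "G \<in> borel_measurable N" using G by auto
  have B: "0 \<le> B" using bound[of undefined undefined] by linarith
  have int: "integrable M (h x)" if x: "x \<in> space N" for x
  proof (rule integrable_const_bound[where B=B])
    show "h x \<in> borel_measurable M" using measurable_Pair2[OF h x] by simp
  qed (use bound in auto)
  have bd: "\<bar>\<integral>y. h x y \<partial>M\<bar> \<le> B * measure M (space M)" for x
  proof (cases "integrable M (h x)")
    case True
    have "\<bar>\<integral>y. h x y \<partial>M\<bar> \<le> (\<integral>y. \<bar>h x y\<bar> \<partial>M)" by (rule integral_abs_bound)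
    also have "\<dots> \<le> (\<integral>y. B \<partial>M)"
      using True bound by (intro integral_mono) auto
    finally show ?thesis by (simp add: mult.commute)
  qed (use B in \<open>simp add: not_integrable_integral_eq\<close>)
  show 1: "integrable N (\<lambda>x. G x * (\<integral>y. h x y \<partial>M))"
  proof (rule Bochner_Integration.integrable_bound)
    show "integrable N (\<lambda>x. G x * (B * measure M (space M)))" using G by simp
    show "AE x in N. norm (G x * (\<integral>y. h x y \<partial>M)) \<le> norm (G x * (B * measure M (space M)))"
      using bd B by (auto simp: abs_mult intro!: AE_I2 mult_left_mono)
  qed measurable
  have "integrable (N \<Otimes>\<^sub>M M) (\<lambda>(x, y). G x * h x y)"
  proof (rule Fubini_integrable)
    show "integrable N (\<lambda>x. \<integral>y. norm (case (x, y) of (x, y) \<Rightarrow> G x * h x y) \<partial>M)"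
    proof (rule Bochner_Integration.integrable_bound)
      show "integrable N (\<lambda>x. G x * (B * measure M (space M)))" using G by simp
      have "(\<integral>y. \<bar>h x y\<bar> \<partial>M) \<le> B * measure M (space M)" if "x \<in> space N" for x
      proof -
        have "(\<integral>y. \<bar>h x y\<bar> \<partial>M) \<le> (\<integral>y. B \<partial>M)"
          using int[OF that] bound by (intro integral_mono) auto
        then show ?thesis by (simp add: mult.commute)
      qed
      then show "AE x in N. norm (\<integral>y. norm (case (x, y) of (x, y) \<Rightarrow> G x * h x y) \<partial>M) \<le> norm (G x * (B * measure M (space M)))"
        using B by (auto simp: abs_mult intro!: AE_I2 mult_left_mono)
    qed measurable
    show "AE x in N. integrable M (\<lambda>y. case (x, y) of (x, y) \<Rightarrow> G x * h x y)"
      using int by (auto intro!: AE_I2)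
  qed measurable
  from Fubini_integral[OF this]
  show "(\<integral>x. G x * (\<integral>y. h x y \<partial>M) \<partial>N) = (\<integral>y. (\<integral>x. G x * h x y \<partial>N) \<partial>M)"
    by simp
qed

text \<open>
  If \<open>f\<close> is the Fourier transform of a nonnegative integrable function, then the double integral of
  \<open>f (x - y)\<close> against \<open>\<mu> \<times> \<mu>\<close> is nonnegative for the signed measure \<open>\<mu> = (\<Sum>x\<in>X. \<delta> x) - r * M\<close>, since it equals
  \<open>\<integral> G s * |\<mu>^ s|\<^sup>2 ds\<close>, where \<open>\<mu>^\<close> denotes the Fourier transform of \<open>\<mu>\<close>. Below, \<open>A s\<close> is this square.
\<close>

lemma positive_definite_signed:
  fixes f G :: "'a::euclidean_space \<Rightarrow> real" and M :: "'a measure" and r :: real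
  assumes M: "finite_measure M" "sets M = sets borel"
    and G: "integrable lborel G" "\<And>y. G y \<ge> 0"
    and f: "\<And>x. f x = (\<integral>y. G y * cos (2 * pi * (x \<bullet> y)) \<partial>lborel)"
  shows "0 \<le> (\<Sum>x\<in>X. \<Sum>y\<in>X. f (x - y)) - 2 * r * (\<Sum>x\<in>X. \<integral>y. f (x - y) \<partial>M)
           + r\<^sup>2 * (\<integral>y. (\<integral>z. f (y - z) \<partial>M) \<partial>M)"
proof -
  interpret M: finite_measure M by fact
  note [measurable_cong] = M(2)
  have [measurable]: "G \<in> borel_measurable borel" using borel_measurable_integrable[OF G(1)] by simp
  let ?c = "\<lambda>x s. cos (2 * pi * (x \<bullet> s))" and ?s = "\<lambda>x s. sin (2 * pi * (x \<bullet> s))"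
  define C where "C s = (\<integral>y. ?c y s \<partial>M)" for s
  define S where "S s = (\<integral>y. ?s y s \<partial>M)" for s
  have ic: "integrable M (\<lambda>y. ?c y s)" and isn: "integrable M (\<lambda>y. ?s y s)" for s
    by (auto intro!: M.integrable_const_bound[where B=1] AE_I2)
  have cd: "?c (x - y) s = ?c x s * ?c y s + ?s x s * ?s y s" for x y s :: 'a
    by (simp add: inner_diff_left right_diff_distrib cos_diff)
  have cM: "(\<integral>y. ?c (x - y) s \<partial>M) = ?c x s * C s + ?s x s * S s" for x s
    unfolding cd C_def S_def using ic isn by simp
  have cMM: "(\<integral>y. (\<integral>z. ?c (y - z) s \<partial>M) \<partial>M) = (C s)\<^sup>2 + (S s)\<^sup>2" for s
    unfolding cM using ic isn by (simp add: C_def[symmetric] S_def[symmetric] power2_eq_square)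
  define A where "A s = (\<Sum>x\<in>X. \<Sum>y\<in>X. ?c (x - y) s) - 2 * r * (\<Sum>x\<in>X. \<integral>y. ?c (x - y) s \<partial>M)
           + r\<^sup>2 * (\<integral>y. (\<integral>z. ?c (y - z) s \<partial>M) \<partial>M)" for s
  have A: "A s = ((\<Sum>x\<in>X. ?c x s) - r * C s)\<^sup>2 + ((\<Sum>x\<in>X. ?s x s) - r * S s)\<^sup>2" for s
  proof -
    have "(\<Sum>x\<in>X. \<Sum>y\<in>X. ?c (x - y) s) = (\<Sum>x\<in>X. ?c x s)\<^sup>2 + (\<Sum>x\<in>X. ?s x s)\<^sup>2"
      unfolding cd by (simp add: sum.distrib power2_eq_square sum_product)
    moreover have "(\<Sum>x\<in>X. \<integral>y. ?c (x - y) s \<partial>M) = (\<Sum>x\<in>X. ?c x s) * C s + (\<Sum>x\<in>X. ?s x s) * S s"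
      unfolding cM by (simp add: sum.distrib sum_distrib_right)
    ultimately show ?thesis unfolding A_def cMM by (simp add: power2_eq_square algebra_simps)
  qed
  have "sigma_finite_measure (lborel :: 'a measure)" ..
  note swap = M.integral_mult_integral_swap[OF this G(1), where B=1]
  have i1: "integrable lborel (\<lambda>s. G s * ?c x s)" for x
    using G(1) by (rule Bochner_Integration.integrable_bound) (auto simp: abs_mult intro!: AE_I2 mult_left_le)
  have i2: "integrable lborel (\<lambda>s. G s * (\<integral>y. ?c (x - y) s \<partial>M))"
    and e2: "(\<integral>s. G s * (\<integral>y. ?c (x - y) s \<partial>M) \<partial>lborel) = (\<integral>y. f (x - y) \<partial>M)" for x
    using swap[of "\<lambda>s y. ?c (x - y) s"] by (auto simp: f)
  have bd: "\<bar>\<integral>z. ?c (y - z) s \<partial>M\<bar> \<le> measure M (space M)" for y s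
  proof -
    have "\<bar>\<integral>z. ?c (y - z) s \<partial>M\<bar> \<le> (\<integral>z. \<bar>?c (y - z) s\<bar> \<partial>M)" by (rule integral_abs_bound)
    also have "\<dots> \<le> (\<integral>z. 1 \<partial>M)"
      by (intro integral_mono M.integrable_const_bound[where B=1]) (auto intro!: AE_I2)
    finally show ?thesis by simp
  qed
  have [measurable]: "(\<lambda>(s, y). \<integral>z. ?c (y - z) s \<partial>M) \<in> borel_measurable (lborel \<Otimes>\<^sub>M M)"
    by measurable
  note swap2 = M.integral_mult_integral_swap[OF \<open>sigma_finite_measure lborel\<close> G(1) this bd]
  have i3: "integrable lborel (\<lambda>s. G s * (\<integral>y. (\<integral>z. ?c (y - z) s \<partial>M) \<partial>M))"
    by (rule swap2(1))
  have e3: "(\<integral>s. G s * (\<integral>y. (\<integral>z. ?c (y - z) s \<partial>M) \<partial>M) \<partial>lborel) = (\<integral>y. (\<integral>z. f (y - z) \<partial>M) \<partial>M)"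
    unfolding swap2(2) e2 ..
  have "0 \<le> (\<integral>s. G s * A s \<partial>lborel)"
    by (intro integral_nonneg_AE AE_I2 mult_nonneg_nonneg G) (simp add: A)
  also have "(\<integral>s. G s * A s \<partial>lborel) =
     (\<integral>s. (\<Sum>x\<in>X. \<Sum>y\<in>X. G s * ?c (x - y) s) - 2 * r * (\<Sum>x\<in>X. G s * (\<integral>y. ?c (x - y) s \<partial>M))
           + r\<^sup>2 * (G s * (\<integral>y. (\<integral>z. ?c (y - z) s \<partial>M) \<partial>M)) \<partial>lborel)"
    unfolding A_def by (intro Bochner_Integration.integral_cong refl)
      (simp add: distrib_left right_diff_distrib sum_distrib_left mult_ac)
  also have "\<dots> = (\<Sum>x\<in>X. \<Sum>y\<in>X. f (x - y)) - 2 * r * (\<Sum>x\<in>X. \<integral>y. f (x - y) \<partial>M)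
           + r\<^sup>2 * (\<integral>y. (\<integral>z. f (y - z) \<partial>M) \<partial>M)"
    using i1 i2 i3 by (simp add: e2 e3 f[symmetric])
  finally show ?thesis .
qed

lemma distr_lborel_reflect:
  "distr lborel borel (\<lambda>y::'a::euclidean_space. x - y) = lborel"
  using lborel_affine[of "-1" x] by (simp add: density_1)

lemma has_bochner_integral_lborel_reflect:
  fixes f :: "'a::euclidean_space \<Rightarrow> real"
  assumes "has_bochner_integral lborel f v"
  shows "has_bochner_integral lborel (\<lambda>y. f (x - y)) v"
proof -
  have [measurable]: "f \<in> borel_measurable borel"
    using borel_measurable_has_bochner_integral[OF assms] by simp
  have "has_bochner_integral (distr lborel borel (\<lambda>y. x - y)) f v"
    using assms by (simp add: distr_lborel_reflect)
  then show ?thesis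
    unfolding has_bochner_integral_iff
    by (subst (asm) integrable_distr_eq, measurable) (subst (asm) integral_distr, auto)
qed

text \<open>
  The linear programming bound in a finite window. In \<open>positive_definite_signed\<close> the measure \<open>M\<close> is Lebesgue measure on
  the ball of radius \<open>R + K\<close>, and \<open>r\<close> is the number of points of \<open>X\<close> divided by its volume. The points lie in the smaller
  ball of radius \<open>R\<close>, so that \<open>\<integral> f (x - y) dM y\<close> differs from the full integral of \<open>f\<close> by at most \<open>\<tau>\<close>; in the
  shell between the two balls it is only bounded by the \<open>L\<^sup>1\<close> norm of \<open>f\<close>.
\<close>

lemma linear_programming_bound_finite:
  fixes f G :: "'a::euclidean_space \<Rightarrow> real" and R K :: real and p :: 'a
  assumes G: "integrable lborel G" "\<And>y. G y \<ge> 0"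
    and f: "\<And>x. f x = (\<integral>y. G y * cos (2 * pi * (x \<bullet> y)) \<partial>lborel)"
    and int: "integrable lborel f"
    and neg: "\<And>x. norm x \<ge> D \<Longrightarrow> f x \<le> 0"
    and X: "finite X" "X \<subseteq> ball p R" "\<And>x y. x \<in> X \<Longrightarrow> y \<in> X \<Longrightarrow> x \<noteq> y \<Longrightarrow> dist x y \<ge> D"
    and RK: "R > 0" "K \<ge> 0"
    and F: "integral\<^sup>L lborel f \<ge> 0"
    and tail: "(\<integral>z. indicator {z. K \<le> norm z} z * \<bar>f z\<bar> \<partial>lborel) \<le> \<tau>"
  shows "real (card X) * (integral\<^sup>L lborel f - 3 * \<tau> -
           (1 - measure lborel (ball p R) / measure lborel (ball p (R + K))) * (\<integral>z. \<bar>f z\<bar> \<partial>lborel))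
         \<le> f 0 * measure lborel (ball p (R + K))"
proof -
  define \<Omega> where "\<Omega> = ball p (R + K)"
  define V where "V = measure lborel \<Omega>"
  define V' where "V' = measure lborel (ball p R)"
  define F where "F = integral\<^sup>L lborel f"
  define L where "L = (\<integral>z. \<bar>f z\<bar> \<partial>lborel)"
  define N where "N = real (card X)"
  define M where "M = density lborel (\<lambda>y. ennreal (indicator \<Omega> y :: real))"
  have [measurable]: "\<Omega> \<in> sets borel" by (simp add: \<Omega>_def)
  have fm [measurable]: "f \<in> borel_measurable borel" using borel_measurable_integrable[OF int] by simp
  have fin: "emeasure lborel (ball q s) < \<infinity>" for q :: 'a and s
    by (intro emeasure_bounded_finite) auto
  have sub: "ball p R \<subseteq> \<Omega>" using RK by (auto simp: \<Omega>_def)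
  have V: "V > 0" unfolding V_def \<Omega>_def using RK by (auto simp: zero_less_measure_iff)
  have VV: "V' \<le> V" unfolding V_def V'_def \<Omega>_def using RK fin
    by (intro measure_mono_fmeasurable) (auto simp: fmeasurable_def)
  have M_sets: "sets M = sets borel" by (simp add: M_def)
  have "emeasure M (space M) = emeasure lborel \<Omega>"
    by (simp add: M_def emeasure_density ennreal_indicator)
  then have M_fin: "finite_measure M" using fin[of p "R + K"] by (intro finite_measureI) (auto simp: \<Omega>_def)
  interpret M: finite_measure M by fact
  note [measurable_cong] = M_sets
  have M_int: "integral\<^sup>L M h = (\<integral>y. indicator \<Omega> y * h y \<partial>lborel)" if "h \<in> borel_measurable borel" for h :: "'a \<Rightarrow> real"
    unfolding M_def using that by (subst integral_density) auto
  define I where "I x = (\<integral>y. f (x - y) \<partial>M)" for x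
  have fi: "integrable lborel (\<lambda>y. f (x - y))" "(\<integral>y. f (x - y) \<partial>lborel) = F" for x
    using has_bochner_integral_lborel_reflect[OF has_bochner_integral_integrable[OF int], of x]
    by (auto simp: has_bochner_integral_iff F_def)
  have fa: "integrable lborel (\<lambda>y. \<bar>f (x - y)\<bar>)" "(\<integral>y. \<bar>f (x - y)\<bar> \<partial>lborel) = L" for x
    using has_bochner_integral_lborel_reflect[OF has_bochner_integral_integrable[OF integrable_abs[OF int]], of x]
    by (auto simp: has_bochner_integral_iff L_def)
  have I_eq: "I x = (\<integral>y. indicator \<Omega> y * f (x - y) \<partial>lborel)" for x
    unfolding I_def by (rule M_int) measurable
  have I_meas [measurable]: "I \<in> borel_measurable borel"
    unfolding I_def[abs_def] by measurable
  have I_abs: "\<bar>I x\<bar> \<le> L" for x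
  proof -
    have "\<bar>I x\<bar> \<le> (\<integral>y. \<bar>indicator \<Omega> y * f (x - y)\<bar> \<partial>lborel)" unfolding I_eq by (rule integral_abs_bound)
    also have "\<dots> \<le> (\<integral>y. \<bar>f (x - y)\<bar> \<partial>lborel)"
      using fa(1)[of x] by (intro integral_mono') (auto simp: indicator_def)
    finally show ?thesis by (simp add: fa)
  qed
  have I_inner: "\<bar>I x - F\<bar> \<le> \<tau>" if x: "x \<in> ball p R" for x
  proof -
    have int1: "integrable lborel (\<lambda>y. indicator \<Omega> y * f (x - y))"
      using fi(1)[of x] by (rule Bochner_Integration.integrable_bound) (auto simp: indicator_def intro!: AE_I2)
    have "I x - F = (\<integral>y. indicator \<Omega> y * f (x - y) - f (x - y) \<partial>lborel)"
      unfolding I_eq fi(2)[of x, symmetric] using int1 fi(1)[of x] by simp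
    also have "\<bar>\<dots>\<bar> \<le> (\<integral>y. \<bar>indicator \<Omega> y * f (x - y) - f (x - y)\<bar> \<partial>lborel)" by (rule integral_abs_bound)
    also have "\<dots> \<le> (\<integral>y. indicator {z. K \<le> norm z} (x - y) * \<bar>f (x - y)\<bar> \<partial>lborel)"
    proof (rule integral_mono')
      show "integrable lborel (\<lambda>y. indicator {z. K \<le> norm z} (x - y) * \<bar>f (x - y)\<bar>)"
        using fa(1)[of x] by (rule Bochner_Integration.integrable_bound) (auto simp: indicator_def intro!: AE_I2)
      fix y
      show "\<bar>indicator \<Omega> y * f (x - y) - f (x - y)\<bar> \<le> indicator {z. K \<le> norm z} (x - y) * \<bar>f (x - y)\<bar>"
      proof (cases "y \<in> \<Omega>")
        case False
        then have "R + K \<le> dist p y" by (simp add: \<Omega>_def)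
        also have "\<dots> \<le> dist p x + norm (x - y)" by (metis dist_norm dist_triangle)
        finally have "K \<le> norm (x - y)" using x by simp
        then show ?thesis using False by simp
      qed simp
    qed auto
    also have "\<dots> = (\<integral>z. indicator {z. K \<le> norm z} z * \<bar>f z\<bar> \<partial>lborel)"
    proof -
      have "integrable lborel (\<lambda>z. indicator {z. K \<le> norm z} z * \<bar>f z\<bar>)"
        using int by (rule Bochner_Integration.integrable_bound) (auto simp: indicator_def intro!: AE_I2)
      from has_bochner_integral_lborel_reflect[OF has_bochner_integral_integrable[OF this], of x]
      show ?thesis by (simp add: has_bochner_integral_iff)
    qed
    finally show ?thesis using tail by simp
  qed
  have diag: "(\<Sum>x\<in>X. \<Sum>y\<in>X. f (x - y)) \<le> N * f 0"
  proof -
    have "(\<Sum>y\<in>X. f (x - y)) \<le> f 0" if x: "x \<in> X" for x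
    proof -
      have "(\<Sum>y\<in>X. f (x - y)) = f 0 + (\<Sum>y\<in>X - {x}. f (x - y))"
        using X(1) x by (simp add: sum.remove)
      also have "(\<Sum>y\<in>X - {x}. f (x - y)) \<le> 0"
        using X(3) x by (intro sum_nonpos neg) (auto simp: dist_norm)
      finally show ?thesis by simp
    qed
    then have "(\<Sum>x\<in>X. \<Sum>y\<in>X. f (x - y)) \<le> (\<Sum>x\<in>X. f 0)" by (rule sum_mono)
    then show ?thesis by (simp add: N_def)
  qed
  have single: "(\<Sum>x\<in>X. I x) \<ge> N * (F - \<tau>)"
  proof -
    have "(\<Sum>x\<in>X. F - \<tau>) \<le> (\<Sum>x\<in>X. I x)"
      using I_inner X(2) by (intro sum_mono) (force simp: abs_le_iff)
    then show ?thesis by (simp add: N_def)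
  qed
  have double: "(\<integral>y. I y \<partial>M) \<le> V' * (F + \<tau>) + (V - V') * L"
  proof -
    have i1: "integrable lborel (indicator A :: 'a \<Rightarrow> real)" if "A \<in> sets borel" "A \<subseteq> \<Omega>" for A
    proof -
      have "emeasure lborel A \<le> emeasure lborel \<Omega>" using that by (intro emeasure_mono) auto
      then show ?thesis using that fin[of p "R + K"] by (intro integrable_real_indicator) (auto simp: \<Omega>_def)
    qed
    have "(\<integral>y. I y \<partial>M) = (\<integral>y. indicator \<Omega> y * I y \<partial>lborel)" by (rule M_int) simp
    also have "\<dots> \<le> (\<integral>y. indicator (ball p R) y * (F + \<tau>) + (indicator \<Omega> y - indicator (ball p R) y) * L \<partial>lborel)"
    proof (rule integral_mono)
      show "integrable lborel (\<lambda>y. indicator \<Omega> y * I y)"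
      proof (rule Bochner_Integration.integrable_bound)
        show "integrable lborel (\<lambda>y. indicator \<Omega> y * L)" using i1[of \<Omega>] by auto
        show "AE y in lborel. norm (indicator \<Omega> y * I y) \<le> norm (indicator \<Omega> y * L)"
          using I_abs by (auto simp: indicator_def intro!: AE_I2 order_trans[OF I_abs])
      qed measurable
      show "integrable lborel (\<lambda>y. indicator (ball p R) y * (F + \<tau>) + (indicator \<Omega> y - indicator (ball p R) y) * L)"
        using i1[of \<Omega>] i1[OF _ sub] by auto
      fix y
      show "indicator \<Omega> y * I y \<le> indicator (ball p R) y * (F + \<tau>) + (indicator \<Omega> y - indicator (ball p R) y) * L"
        using I_abs[of y] I_inner[of y] sub by (auto simp: indicator_def abs_le_iff)
    qed
    also have "\<dots> = V' * (F + \<tau>) + (V - V') * L"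
      using i1[of \<Omega>] i1[OF _ sub] by (simp add: V_def V'_def)
    finally show ?thesis .
  qed
  define r where "r = N / V"
  have r: "r \<ge> 0" using V by (simp add: r_def N_def)
  have "0 \<le> (\<Sum>x\<in>X. \<Sum>y\<in>X. f (x - y)) - 2 * r * (\<Sum>x\<in>X. I x) + r\<^sup>2 * (\<integral>y. I y \<partial>M)"
    unfolding I_def by (rule positive_definite_signed[OF M_fin M_sets G f])
  also have "\<dots> \<le> N * f 0 - 2 * r * (N * (F - \<tau>)) + r\<^sup>2 * (V' * (F + \<tau>) + (V - V') * L)"
    using diag single double r by (intro add_mono diff_mono mult_left_mono) auto
  finally have main: "0 \<le> N * f 0 - 2 * r * (N * (F - \<tau>)) + r\<^sup>2 * (V' * (F + \<tau>) + (V - V') * L)" .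
  show ?thesis
  proof (cases "N = 0")
    case True
    have "0 \<le> f 0" unfolding f using G by (auto intro!: integral_nonneg_AE AE_I2)
    then show ?thesis using True V by (simp add: N_def V_def \<Omega>_def)
  next
    case False
    then have N: "N > 0" by (simp add: N_def)
    have "0 \<le> (\<integral>z. indicator {z. K \<le> norm z} z * \<bar>f z\<bar> \<partial>lborel)"
      by (intro integral_nonneg_AE AE_I2) (auto simp: indicator_def)
    with tail F have "F + \<tau> \<ge> 0" unfolding F_def by linarith
    then have "V' * (F + \<tau>) + (V - V') * L \<le> V * (F + \<tau>) + (V - V') * L"
      using VV by (intro add_right_mono mult_right_mono) auto
    then have "r\<^sup>2 * (V' * (F + \<tau>) + (V - V') * L) \<le> r\<^sup>2 * (V * (F + \<tau>) + (V - V') * L)"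
      by (intro mult_left_mono) auto
    with main have "0 \<le> N * f 0 - 2 * r * (N * (F - \<tau>)) + r\<^sup>2 * (V * (F + \<tau>) + (V - V') * L)"
      by linarith
    also have "\<dots> = N / V * (f 0 * V - N * (F - 3 * \<tau> - (1 - V' / V) * L))"
      using V by (simp add: r_def field_simps power2_eq_square)
    finally have "0 \<le> f 0 * V - N * (F - 3 * \<tau> - (1 - V' / V) * L)"
      using N V by (simp add: zero_le_mult_iff zero_le_divide_iff)
    then show ?thesis by (simp add: N_def V_def V'_def F_def L_def \<Omega>_def)
  qed
qed

section \<open>Sphere packings\<close>

lemma tail_integral_tendsto_0:
  fixes f :: "'a::euclidean_space \<Rightarrow> real"
  assumes f: "integrable lborel f"
  shows "(\<lambda>k::nat. \<integral>z. indicator {z. real k \<le> norm z} z * \<bar>f z\<bar> \<partial>lborel) \<longlonglongrightarrow> 0"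
proof -
  have [measurable]: "f \<in> borel_measurable borel" using borel_measurable_integrable[OF f] by simp
  have "(\<lambda>k::nat. \<integral>z. indicator {z. real k \<le> norm z} z * \<bar>f z\<bar> \<partial>lborel) \<longlonglongrightarrow> (\<integral>z. 0 \<partial>(lborel :: 'a measure))"
  proof (rule integral_dominated_convergence)
    show "integrable lborel (\<lambda>z. \<bar>f z\<bar>)" using f by simp
    show "AE z in lborel. (\<lambda>k::nat. indicator {z. real k \<le> norm z} z * \<bar>f z\<bar>) \<longlonglongrightarrow> 0"
    proof (rule AE_I2)
      fix z :: 'a
      have "eventually (\<lambda>k. indicator {z. real k \<le> norm z} z * \<bar>f z\<bar> = 0) sequentially"
        using eventually_gt_at_top[of "nat \<lceil>norm z\<rceil>"]
        by eventually_elim (auto simp: indicator_def, linarith)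
      then show "(\<lambda>k::nat. indicator {z. real k \<le> norm z} z * \<bar>f z\<bar>) \<longlonglongrightarrow> 0"
        by (rule tendsto_eventually)
    qed
  qed (auto simp: indicator_def)
  then show ?thesis by simp
qed

text \<open>
  Letting first the radius and then the margin of the window grow: a set with minimal distance \<open>D\<close> has
  asymptotically at most \<open>f 0 / \<integral> f\<close> points per unit volume, uniformly in the position of the window.
\<close>

lemma linear_programming_bound_count:
  fixes f G :: "'a::euclidean_space \<Rightarrow> real"
  assumes G: "integrable lborel G" "\<And>y. G y \<ge> 0"
    and f: "\<And>x. f x = (\<integral>y. G y * cos (2 * pi * (x \<bullet> y)) \<partial>lborel)"
    and int: "integrable lborel f"
    and neg: "\<And>x. norm x \<ge> D \<Longrightarrow> f x \<le> 0"
    and F: "integral\<^sup>L lborel f > 0"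
    and C: "\<And>x y. x \<in> C \<Longrightarrow> y \<in> C \<Longrightarrow> x \<noteq> y \<Longrightarrow> dist x y \<ge> D"
    and c: "f 0 < c * integral\<^sup>L lborel f"
  shows "\<forall>\<^sub>F R in at_top. \<forall>(p::'a) X. finite X \<longrightarrow> X \<subseteq> C \<inter> ball p R \<longrightarrow>
           real (card X) \<le> c * measure lborel (ball p R)"
proof -
  define F where "F = integral\<^sup>L lborel f"
  define L where "L = (\<integral>z. \<bar>f z\<bar> \<partial>lborel)"
  have f0: "0 \<le> f 0" unfolding f using G by (auto intro!: integral_nonneg_AE AE_I2)
  have c0: "c > 0" using f0 c F by (metis less_le_trans not_le order_less_imp_le zero_less_mult_pos2 order.strict_trans1)
  define \<tau> where "\<tau> = (c * F - f 0) / (4 * c)"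
  have \<tau>: "\<tau> > 0" "f 0 < c * (F - 3 * \<tau>)"
    using c c0 by (auto simp: \<tau>_def F_def field_simps)
  obtain k :: nat where k: "(\<integral>z. indicator {z. real k \<le> norm z} z * \<bar>f z\<bar> \<partial>lborel) < \<tau>"
    using order_tendstoD(2)[OF tail_integral_tendsto_0[OF int] \<tau>(1)] by (auto simp: eventually_sequentially)
  define q where "q R = (R / (R + real k)) ^ DIM('a)" for R
  have "(q \<longlongrightarrow> 1 ^ DIM('a)) at_top"
    unfolding q_def[abs_def] by (intro tendsto_power) real_asymp
  then have q: "(q \<longlongrightarrow> 1) at_top" by simp
  have "((\<lambda>R. c * (F - 3 * \<tau> - (1 - q R) * L) * q R) \<longlongrightarrow> c * (F - 3 * \<tau> - (1 - 1) * L) * 1) at_top"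
    by (intro tendsto_intros q)
  then have "\<forall>\<^sub>F R in at_top. f 0 < c * (F - 3 * \<tau> - (1 - q R) * L) * q R"
    using \<tau>(2) by (intro order_tendstoD(1)) auto
  then show ?thesis
    using eventually_gt_at_top[of 0]
  proof eventually_elim
    case (elim R)
    show ?case
    proof (intro allI impI)
      fix p :: 'a and X assume X: "finite X" "X \<subseteq> C \<inter> ball p R"
      define V where "V = measure lborel (ball p (R + real k))"
      define V' where "V' = measure lborel (ball p R)"
      define A where "A = F - 3 * \<tau> - (1 - q R) * L"
      have Veq: "V = unit_ball_vol DIM('a) * (R + real k) ^ DIM('a)" "V' = unit_ball_vol DIM('a) * R ^ DIM('a)"
        unfolding V_def V'_def using elim by (simp_all add: content_ball)
      have V: "V > 0" "V' > 0" using elim by (auto simp: Veq)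
      have qV: "V' / V = q R" using elim unit_ball_vol_pos[of "real DIM('a)"] by (simp add: Veq q_def power_divide del: unit_ball_vol_pos)
      have "real (card X) * (integral\<^sup>L lborel f - 3 * \<tau> -
           (1 - measure lborel (ball p R) / measure lborel (ball p (R + real k))) * (\<integral>z. \<bar>f z\<bar> \<partial>lborel))
         \<le> f 0 * measure lborel (ball p (R + real k))"
      proof (rule linear_programming_bound_finite[OF G f int neg])
        show "dist x y \<ge> D" if "x \<in> X" "y \<in> X" "x \<noteq> y" for x y using that X C by blast
      qed (use X elim k F in auto)
      then have main: "real (card X) * A \<le> f 0 * V"
        by (simp add: A_def F_def[symmetric] L_def[symmetric] V_def[symmetric] V'_def[symmetric] qV)
      have q0: "q R > 0" using V unfolding qV[symmetric] by simp
      have Aq: "f 0 < c * A * q R" using elim by (simp add: A_def)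
      then have A0: "A > 0" using f0 q0 c0
        by (smt (verit) mult_nonneg_nonpos mult_nonpos_nonneg)
      have "real (card X) * A \<le> f 0 * V" by (rule main)
      also have "\<dots> \<le> (c * A * q R) * V" using Aq V by (intro mult_right_mono) auto
      also have "\<dots> = (c * V') * A" using V by (simp add: qV[symmetric])
      finally show "real (card X) \<le> c * measure lborel (ball p R)"
        using A0 by (simp add: V'_def)
    qed
  qed
qed

lemma sphere_packing_centers:
  fixes P :: "(real ^ 'n) set set"
  assumes "sphere_packing P"
  obtains \<rho> where "\<rho> > 0" "\<And>B. B \<in> P \<Longrightarrow> \<exists>c. B = cball c \<rho>"
    "\<And>x y. cball x \<rho> \<in> P \<Longrightarrow> cball y \<rho> \<in> P \<Longrightarrow> x \<noteq> y \<Longrightarrow> dist x y \<ge> 2 * \<rho>"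
proof -
  from assms have 1: "\<exists>\<rho>>0. \<forall>B\<in>P. \<exists>c. B = cball c \<rho>"
    and 2: "\<forall>B\<in>P. \<forall>B'\<in>P. B \<noteq> B' \<longrightarrow> B \<inter> B' \<subseteq> frontier B \<inter> frontier B'"
    unfolding sphere_packing_def by (rule conjunct1, rule conjunct2)
  from 1 obtain \<rho> where \<rho>: "\<rho> > 0" "\<And>B. B \<in> P \<Longrightarrow> \<exists>c. B = cball c \<rho>"
    by auto
  have "dist x y \<ge> 2 * \<rho>" if xy: "cball x \<rho> \<in> P" "cball y \<rho> \<in> P" "x \<noteq> y" for x y
  proof (rule ccontr)
    assume "\<not> dist x y \<ge> 2 * \<rho>"
    then have m: "dist x (midpoint x y) < \<rho>" "dist y (midpoint x y) < \<rho>"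
      by (simp_all add: dist_midpoint)
    have "cball x \<rho> \<noteq> cball y \<rho>" using xy(3) \<rho>(1) by (simp add: cball_eq_cball_iff)
    then have "cball x \<rho> \<inter> cball y \<rho> \<subseteq> frontier (cball x \<rho>)"
      using 2[rule_format, OF xy(1,2)] by (simp only: le_inf_iff) simp
    moreover have "midpoint x y \<in> cball x \<rho> \<inter> cball y \<rho>" using m by simp
    ultimately have "midpoint x y \<in> sphere x \<rho>" using frontier_cball by blast
    with m(1) show False by simp
  qed
  with \<rho> show thesis by (rule that)
qed

lemma upper_density_le:
  fixes P :: "(real ^ 'n) set set" and f G :: "real ^ 'n \<Rightarrow> real"
  assumes \<rho>: "\<rho> > 0" "\<And>B. B \<in> P \<Longrightarrow> \<exists>c. B = cball c \<rho>"
    and sep: "\<And>x y. cball x \<rho> \<in> P \<Longrightarrow> cball y \<rho> \<in> P \<Longrightarrow> x \<noteq> y \<Longrightarrow> dist x y \<ge> 2 * \<rho>"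
    and G: "integrable lborel G" "\<And>y. G y \<ge> 0"
    and f: "\<And>x. f x = (\<integral>y. G y * cos (2 * pi * (x \<bullet> y)) \<partial>lborel)"
    and int: "integrable lborel f"
    and neg: "\<And>x. norm x \<ge> 2 * \<rho> \<Longrightarrow> f x \<le> 0"
    and F: "integral\<^sup>L lborel f > 0"
  shows "upper_density P \<le> ereal (f 0 / integral\<^sup>L lborel f * (unit_ball_vol CARD('n) * \<rho> ^ CARD('n)))"
proof (rule dense_ge)
  define \<omega> where "\<omega> = unit_ball_vol CARD('n)"
  define n where "n = CARD('n)"
  define F where "F = integral\<^sup>L lborel f"
  have \<omega>: "\<omega> > 0" by (simp add: \<omega>_def)
  fix z assume z: "ereal (f 0 / integral\<^sup>L lborel f * (unit_ball_vol CARD('n) * \<rho> ^ CARD('n))) < z"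
  show "upper_density P \<le> z"
  proof (cases z)
    case (real e)
    then have e: "f 0 / F * (\<omega> * \<rho> ^ n) < e" using z by (simp add: F_def \<omega>_def n_def)
    have pos: "\<omega> * \<rho> ^ n > 0" using \<omega> \<rho> by simp
    have "f 0 / F < e / (\<omega> * \<rho> ^ n)" using e pos by (simp add: field_simps)
    then obtain c where c: "f 0 / F < c" "c < e / (\<omega> * \<rho> ^ n)" using dense by blast
    have c1: "f 0 < c * integral\<^sup>L lborel f" using c F by (simp add: F_def field_simps)
    have c2: "c * (\<omega> * \<rho> ^ n) < e" using c pos by (simp add: field_simps)
    define C where "C = {x. cball x \<rho> \<in> P}"
    have Csep: "dist x y \<ge> 2 * \<rho>" if "x \<in> C" "y \<in> C" "x \<noteq> y" for x y
      using that sep by (simp add: C_def)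
    have ev: "\<forall>\<^sub>F R in at_top. \<forall>p X. finite X \<longrightarrow> X \<subseteq> C \<inter> ball p R \<longrightarrow>
           real (card X) \<le> c * measure lborel (ball p R)"
      by (rule linear_programming_bound_count[OF G f int neg F Csep c1])
    have "filterlim (\<lambda>r. r + \<rho>) at_top at_top"
      by real_asymp
    then have ev': "\<forall>\<^sub>F r in at_top. \<forall>p X. finite X \<longrightarrow> X \<subseteq> C \<inter> ball p (r + \<rho>) \<longrightarrow>
           real (card X) \<le> c * measure lborel (ball p (r + \<rho>))"
      using ev by (rule eventually_compose_filterlim[rotated])
    have "((\<lambda>r. c * (\<omega> * \<rho> ^ n) * ((r + \<rho>) / r) ^ n) \<longlongrightarrow> c * (\<omega> * \<rho> ^ n) * 1 ^ n) at_top"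
      by (intro tendsto_intros) real_asymp
    then have "\<forall>\<^sub>F r in at_top. c * (\<omega> * \<rho> ^ n) * ((r + \<rho>) / r) ^ n < e"
      using c2 by (intro order_tendstoD(2)) auto
    with ev' have "\<forall>\<^sub>F r in at_top. (SUP p. ereal
       (measure lebesgue (ball p r \<inter> \<Union>P) / measure lebesgue (ball p r))) \<le> ereal e"
      using eventually_gt_at_top[of 0]
    proof eventually_elim
      case (elim r)
      show ?case
      proof (rule SUP_least, simp only: ereal_less_eq)
        fix p :: "real ^ 'n"
        define X where "X = C \<inter> ball p (r + \<rho>)"
        define B where "B = c * measure lborel (ball p (r + \<rho>))"
        have bd: "real (card Y) \<le> B" if "finite Y" "Y \<subseteq> X" for Y
          using elim(1) that by (simp add: X_def B_def)
        have fin: "finite X"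
        proof (rule ccontr)
          assume "infinite X"
          from infinite_arbitrarily_large[OF this, of "nat \<lceil>B\<rceil> + 1"]
          obtain Y where Y: "finite Y" "card Y = nat \<lceil>B\<rceil> + 1" "Y \<subseteq> X" by blast
          with bd[of Y] show False by linarith
        qed
        have vol: "measure lebesgue (ball q s) = \<omega> * s ^ n" "measure lebesgue (cball q s) = \<omega> * s ^ n"
          if "s \<ge> 0" for q :: "real ^ 'n" and s
          using content_ball[OF that, of q] content_cball[OF that, of q] by (simp_all add: \<omega>_def n_def)
        have sub: "ball p r \<inter> \<Union>P \<subseteq> (\<Union>x\<in>X. cball x \<rho>)"
        proof
          fix y assume y: "y \<in> ball p r \<inter> \<Union>P"
          then obtain x where x: "cball x \<rho> \<in> P" "y \<in> cball x \<rho>" using \<rho>(2) by blast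
          have "dist p x \<le> dist p y + dist y x" by (rule dist_triangle)
          also have "\<dots> < r + \<rho>" using x y by (simp add: dist_commute)
          finally show "y \<in> (\<Union>x\<in>X. cball x \<rho>)" using x by (auto simp: X_def C_def)
        qed
        have "measure lebesgue (ball p r \<inter> \<Union>P) \<le> measure lebesgue (\<Union>x\<in>X. cball x \<rho>)"
        proof (cases "ball p r \<inter> \<Union>P \<in> sets lebesgue")
          case True
          then show ?thesis using sub fin by (intro measure_mono_fmeasurable) (auto intro!: fmeasurable.finite_UN)
        qed (simp add: measure_notin_sets)
        also have "\<dots> \<le> (\<Sum>x\<in>X. measure lebesgue (cball x \<rho>))"
          using fin by (intro measure_UNION_le) auto
        also have "\<dots> = real (card X) * (\<omega> * \<rho> ^ n)" by (simp only: vol(2)[OF less_imp_le[OF \<rho>(1)]] sum_constant)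
        also have "\<dots> \<le> B * (\<omega> * \<rho> ^ n)" using bd[OF fin] pos by (intro mult_right_mono) auto
        also have "B = c * (\<omega> * (r + \<rho>) ^ n)"
          using vol(1)[of "r + \<rho>" p] elim(3) \<rho> by (simp add: B_def)
        finally have "measure lebesgue (ball p r \<inter> \<Union>P) / measure lebesgue (ball p r)
            \<le> c * (\<omega> * (r + \<rho>) ^ n) * (\<omega> * \<rho> ^ n) / (\<omega> * r ^ n)"
          unfolding vol(1)[OF less_imp_le[OF elim(3)]]
          using elim(3) \<omega> by (rule_tac divide_right_mono) auto
        also have "\<dots> = c * (\<omega> * \<rho> ^ n) * ((r + \<rho>) / r) ^ n"
          using \<omega> elim(3) by (simp add: power_divide)
        also have "\<dots> \<le> e" using elim(2) by simp
        finally show "measure lebesgue (ball p r \<inter> \<Union>P) / measure lebesgue (ball p r) \<le> e" .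
      qed
    qed
    then show ?thesis unfolding upper_density_def real by (rule Limsup_bounded)
  qed (use z in auto)
qed

text \<open>
  The Cohn-Elkies bound for \<open>f x = p (pi * |x|\<^sup>2 / u) * exp (- pi * |x|\<^sup>2 / u)\<close>, with \<open>u\<close> chosen such that the sign
  change of \<open>p\<close> at \<open>t0\<close> takes place at the minimal distance \<open>2 * \<rho>\<close> of the centers.
\<close>

theorem center_density_le_poly:
  fixes P :: "(real ^ 'n) set set" and p g :: "nat \<Rightarrow> real"
  assumes P: "sphere_packing P"
    and m: "m = real CARD('n) / 2"
    and reflect: "\<And>x. (\<Sum>k\<le>d. g k * pochhammer m k * x ^ k) = (\<Sum>k\<le>d. p k * pochhammer m k * (1 - x) ^ k)"
    and t0: "t0 > 0"
    and p: "\<And>t. t \<ge> t0 \<Longrightarrow> (\<Sum>k\<le>d. p k * t ^ k) \<le> 0"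
    and g: "\<And>t. t \<ge> 0 \<Longrightarrow> (\<Sum>k\<le>d. g k * t ^ k) \<ge> 0"
    and g0: "g 0 > 0"
  shows "center_density P \<le> ereal ((t0 / (4 * pi)) powr m * (p 0 / g 0))"
proof -
  obtain \<rho> where \<rho>: "\<rho> > 0" "\<And>B. B \<in> P \<Longrightarrow> \<exists>c. B = cball c \<rho>"
    "\<And>x y. cball x \<rho> \<in> P \<Longrightarrow> cball y \<rho> \<in> P \<Longrightarrow> x \<noteq> y \<Longrightarrow> dist x y \<ge> 2 * \<rho>"
    using sphere_packing_centers[OF P] by blast
  define u where "u = 4 * pi * \<rho>\<^sup>2 / t0"
  have u: "u > 0" using \<rho>(1) t0 by (simp add: u_def)
  have m': "m = real DIM(real ^ 'n) / 2" by (simp add: m)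
  define f :: "real ^ 'n \<Rightarrow> real"
    where "f x = (\<Sum>k\<le>d. p k * (pi * (norm x)\<^sup>2 / u) ^ k) * exp (- (pi * (norm x)\<^sup>2 / u))" for x
  define G :: "real ^ 'n \<Rightarrow> real"
    where "G y = u powr m * ((\<Sum>k\<le>d. g k * (u * (pi * (norm y)\<^sup>2)) ^ k) * exp (- (u * (pi * (norm y)\<^sup>2))))" for y
  have G: "integrable lborel G"
    unfolding G_def[abs_def] by (rule gaussian_poly_transform_integrable[OF reflect m' u])
  have G0: "G y \<ge> 0" for y
    unfolding G_def using u by (intro mult_nonneg_nonneg g) auto
  have f: "f x = (\<integral>y. G y * cos (2 * pi * (x \<bullet> y)) \<partial>lborel)" for x
    unfolding f_def G_def by (rule gaussian_poly_transform[OF reflect m' u])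
  have F: "has_bochner_integral lborel f (u powr m * g 0)"
    unfolding f_def[abs_def] by (rule gaussian_poly_integral[OF reflect m' u])
  then have fi: "integrable lborel f" "integral\<^sup>L lborel f = u powr m * g 0"
    by (auto simp: has_bochner_integral_iff)
  have neg: "f x \<le> 0" if "norm x \<ge> 2 * \<rho>" for x
  proof -
    have "4 * \<rho>\<^sup>2 \<le> (norm x)\<^sup>2" using power_mono[OF that, of 2] \<rho>(1) by (simp add: power_mult_distrib)
    then have "t0 \<le> pi * (norm x)\<^sup>2 / u"
      using \<rho>(1) t0 by (simp add: u_def field_simps)
    then show ?thesis unfolding f_def by (intro mult_nonpos_nonneg p) auto
  qed
  have f0: "f 0 = p 0"
    by (simp add: f_def power_0_left if_distrib[where f="\<lambda>x. _ * x"] sum.delta cong: if_cong)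
  have um: "u powr m = \<rho> ^ CARD('n) / (t0 / (4 * pi)) powr m"
  proof -
    have "u = \<rho>\<^sup>2 / (t0 / (4 * pi))" using t0 by (simp add: u_def)
    then have "u powr m = (\<rho>\<^sup>2) powr m / (t0 / (4 * pi)) powr m"
      using \<rho>(1) t0 by (simp only: powr_divide)
    also have "(\<rho>\<^sup>2) powr m = \<rho> ^ CARD('n)"
      using \<rho>(1) by (simp add: m powr_realpow[symmetric] powr_powr flip: powr_numeral)
    finally show ?thesis .
  qed
  define \<omega> where "\<omega> = unit_ball_vol CARD('n)"
  have \<omega>: "\<omega> > 0" by (simp add: \<omega>_def)
  have T: "(t0 / (4 * pi)) powr m > 0" using t0 by simp
  have "upper_density P \<le> ereal (f 0 / integral\<^sup>L lborel f * (\<omega> * \<rho> ^ CARD('n)))"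
    unfolding \<omega>_def using u g0
    by (intro upper_density_le[OF \<rho> G G0 f fi(1) neg]) (auto simp: fi(2))
  also have "f 0 / integral\<^sup>L lborel f * (\<omega> * \<rho> ^ CARD('n)) = (t0 / (4 * pi)) powr m * (p 0 / g 0) * \<omega>"
    unfolding fi(2) um f0 using \<rho>(1) T by (simp add: field_simps)
  finally have "upper_density P \<le> ereal ((t0 / (4 * pi)) powr m * (p 0 / g 0) * \<omega>)" .
  then have "upper_density P \<le> ereal \<omega> * ereal ((t0 / (4 * pi)) powr m * (p 0 / g 0))"
    by (simp add: mult.commute)
  moreover have "pi powr (real CARD('n) / 2) / Gamma (real CARD('n) / 2 + 1) = \<omega>"
    by (simp only: \<omega>_def unit_ball_vol_def)
  ultimately show ?thesis
    unfolding center_density_def using \<omega>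
    by (metis ereal_divide_le_pos ereal_less(2) PInfty_neq_ereal(1))
qed

section \<open>Integer certificates\<close>

text \<open>
  Integer polynomials are lists of coefficients, lowest degree first. Everything is set up such that
  rewriting with the defining equations and with binary arithmetic evaluates a certificate.
\<close>

fun list_add :: "int list \<Rightarrow> int list \<Rightarrow> int list" where
  "list_add [] ys = ys"
| "list_add (x # xs) [] = x # xs"
| "list_add (x # xs) (y # ys) = (x + y) # list_add xs ys"

fun list_scale :: "int \<Rightarrow> int list \<Rightarrow> int list" where
  "list_scale c [] = []"
| "list_scale c (x # xs) = c * x # list_scale c xs"

fun list_square :: "int list \<Rightarrow> int list" where
  "list_square [] = []"
| "list_square (x # xs) = list_add (x * x # list_scale (2 * x) xs) (0 # 0 # list_square xs)"

text \<open>
  \<open>list_times_linear a b c xs\<close> is the product of \<open>xs\<close> with \<open>a + b * X\<close>, plus the constant \<open>b * c\<close>; the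
  argument \<open>c\<close> carries the preceding coefficient and is zero at the start.
\<close>

fun list_times_linear :: "int \<Rightarrow> int \<Rightarrow> int \<Rightarrow> int list \<Rightarrow> int list" where
  "list_times_linear a b c [] = [b * c]"
| "list_times_linear a b c (x # xs) = (a * x + b * c) # list_times_linear a b x xs"

text \<open>
  The substitution of \<open>1 - X\<close> for \<open>X\<close> by Horner's scheme. A step \<open>list_horner_step c xs\<close> is
  \<open>c + (1 - X) * xs\<close>, and \<open>list_minus_shift c xs\<close> is \<open>(1 - X) * xs - c\<close>.
\<close>

fun list_minus_shift :: "int \<Rightarrow> int list \<Rightarrow> int list" where
  "list_minus_shift c [] = [- c]"
| "list_minus_shift c (x # xs) = (x - c) # list_minus_shift x xs"

fun list_horner_step :: "int \<Rightarrow> int list \<Rightarrow> int list" where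
  "list_horner_step c [] = [c]"
| "list_horner_step c (x # xs) = (c + x) # list_minus_shift x xs"

fun list_reflect :: "int list \<Rightarrow> int list" where
  "list_reflect [] = []"
| "list_reflect (x # xs) = list_horner_step x (list_reflect xs)"

text \<open>
  Multiplication of the coefficient of index \<open>k\<close> by \<open>w * (n * (n + 2) * \<dots> * (n + 2 * (k - 1)))\<close>. For \<open>w = 1\<close>
  this is \<open>2 ^ k * pochhammer (n / 2) k\<close>; the power of two belongs to the use of \<open>s = 2 * t\<close> as the variable of
  the integer polynomials.
\<close>

fun list_weight :: "int \<Rightarrow> int \<Rightarrow> int list \<Rightarrow> int list" where
  "list_weight w n [] = []"
| "list_weight w n (x # xs) = w * x # list_weight (w * n) (n + 2) xs"

text \<open>\<open>weighted_le w n hs gs\<close>: the list \<open>list_weight w n hs\<close> is bounded by \<open>gs\<close> coefficient by coefficient.\<close>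

fun weighted_le :: "int \<Rightarrow> int \<Rightarrow> int list \<Rightarrow> int list \<Rightarrow> bool" where
  "weighted_le w n [] [] = True"
| "weighted_le w n (h # hs) (g # gs) = (w * h \<le> g \<and> weighted_le (w * n) (n + 2) hs gs)"
| "weighted_le w n [] (g # gs) = False"
| "weighted_le w n (h # hs) [] = False"

text \<open>
  The conditions on the polynomial \<open>ps\<close> of \<open>f\<close>, on the weighted polynomial \<open>gs\<close> of its transform and on the
  nonnegative polynomial \<open>h\<close>: the transform is positive at the origin and dominates \<open>h\<close>, and \<open>a / b\<close> is an
  upper bound for the quotient of the values of \<open>f\<close> and of its transform at the origin.
\<close>

fun transform_ineqs :: "int \<Rightarrow> int \<Rightarrow> int \<Rightarrow> int list \<Rightarrow> int list \<Rightarrow> int list \<Rightarrow> bool" where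
  "transform_ineqs n a b (p # ps) (g # gs) h = (0 < g \<and> p * b \<le> a * g \<and> weighted_le 1 n h (g # gs))"
| "transform_ineqs n a b [] gs h = False"
| "transform_ineqs n a b (p # ps) [] h = False"

(* A function of its own, so that the list ps is evaluated before it is duplicated. *)
fun poly_ineqs :: "int \<Rightarrow> int \<Rightarrow> int \<Rightarrow> int list \<Rightarrow> int list \<Rightarrow> bool" where
  "poly_ineqs n a b ps h = transform_ineqs n a b ps (list_reflect (list_weight 1 n ps)) h"

text \<open>
  A certificate that the center density in dimension \<open>n\<close> is at most \<open>U / 10 ^ 5\<close>. With \<open>s = 2 * pi * |x|\<^sup>2\<close>, the
  function used in the linear programming bound is \<open>p s * exp (- s / 2)\<close> up to scaling, where
  \<open>p = (num - den * s) * (A\<^sup>2 + (den * s - num) * B\<^sup>2)\<close>, so that \<open>p\<close> is nonpositive for \<open>s \<ge> num / den\<close> by its form.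
  The transform of \<open>p\<close> is nonnegative for \<open>s \<ge> 0\<close> because its coefficients are at least those of \<open>C\<^sup>2 + s * E\<^sup>2\<close>.
  Every polynomial that is positive on a half-line has the form of such a sum of two weighted squares of real
  polynomials, so asking for it loses nothing but the rounding of coefficients. The remaining conditions are a rational estimate of
  \<open>(num / (8 * pi * den)) powr (n / 2) * (p 0 / g 0)\<close>: \<open>kn / kd\<close> bounds \<open>num / (8 * pi * den)\<close> and \<open>a / b\<close> bounds
  \<open>p 0 / g 0\<close>, where \<open>3.141592653588\<close> is a lower bound for \<open>pi\<close>.
\<close>

definition certificate ::
  "nat \<Rightarrow> int \<Rightarrow> int \<Rightarrow> int \<Rightarrow> int \<Rightarrow> int \<Rightarrow> int \<Rightarrow> int \<Rightarrow> int list \<Rightarrow> int list \<Rightarrow> int list \<Rightarrow> int list \<Rightarrow> bool"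
  where
  "certificate n U num den a b kn kd A B C E \<longleftrightarrow>
     0 < num \<and> 0 < den \<and> 0 \<le> a \<and> 0 < b \<and> 0 < kn \<and> 0 < kd \<and> 0 \<le> U \<and>
     num * kd * 1000000000000 \<le> 8 * den * kn * 3141592653588 \<and>
     kn ^ n * a ^ 2 * 10000000000 \<le> U ^ 2 * b ^ 2 * kd ^ n \<and>
     poly_ineqs (int n) a b
       (list_times_linear num (- den) 0
         (list_add (list_square A) (list_times_linear (- num) den 0 (list_square B))))
       (list_add (list_square C) (0 # list_square E))"

text \<open>
  The value at a real number of the polynomial with the given coefficients, lowest degree first.
\<close>

fun list_poly :: "int list \<Rightarrow> real \<Rightarrow> real" where
  "list_poly [] x = 0"
| "list_poly (c # cs) x = of_int c + x * list_poly cs x"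

lemma list_poly_list_add: "list_poly (list_add xs ys) x = list_poly xs x + list_poly ys x"
  by (induction xs ys rule: list_add.induct) (auto simp: algebra_simps)

lemma list_poly_list_scale: "list_poly (list_scale c xs) x = of_int c * list_poly xs x"
  by (induction xs) (auto simp: algebra_simps)

lemma list_poly_list_square: "list_poly (list_square xs) x = (list_poly xs x)\<^sup>2"
  by (induction xs) (auto simp: list_poly_list_add list_poly_list_scale power2_eq_square algebra_simps)

lemma list_poly_list_times_linear: "list_poly (list_times_linear a b c xs) x = (of_int a + of_int b * x) * list_poly xs x + of_int (b * c)"
  by (induction xs arbitrary: c) (auto simp: algebra_simps)

lemma list_poly_list_minus_shift: "list_poly (list_minus_shift c xs) x = (1 - x) * list_poly xs x - of_int c"
proof (induction xs arbitrary: c)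
  case (Cons y ys)
  show ?case by (simp only: list_minus_shift.simps list_poly.simps Cons.IH) (simp add: algebra_simps)
qed simp

lemma list_poly_list_reflect: "list_poly (list_reflect xs) x = list_poly xs (1 - x)"
proof (induction xs)
  case (Cons c xs)
  have "list_poly (list_horner_step c ys) x = of_int c + (1 - x) * list_poly ys x" for ys
    by (cases ys) (auto simp: list_poly_list_minus_shift algebra_simps)
  with Cons show ?case by simp
qed simp

text \<open>
  The coefficient of index \<open>k\<close>, zero beyond the end of the list.
\<close>

definition coef :: "int list \<Rightarrow> nat \<Rightarrow> real" where
  "coef xs k = (if k < length xs then of_int (xs ! k) else 0)"

lemma coef_simps [simp]: "coef [] k = 0" "coef (x # xs) 0 = of_int x" "coef (x # xs) (Suc k) = coef xs k"
  by (auto simp: coef_def)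

lemma list_poly_eq_sum: "length xs \<le> Suc d \<Longrightarrow> list_poly xs x = (\<Sum>k\<le>d. coef xs k * x ^ k)"
proof (induction xs arbitrary: d)
  case (Cons c xs)
  show ?case
  proof (cases d)
    case 0
    with Cons.prems show ?thesis by simp
  next
    case (Suc d')
    with Cons.IH[of d'] Cons.prems have "list_poly xs x = (\<Sum>k\<le>d'. coef xs k * x ^ k)" by simp
    then show ?thesis by (simp add: Suc sum.atMost_Suc_shift sum_distrib_left mult_ac del: sum.atMost_Suc)
  qed
qed simp

lemma coef_list_weight: "coef (list_weight w n xs) k = of_int w * (2 ^ k * pochhammer (of_int n / 2) k) * coef xs k"
proof (induction xs arbitrary: w n k)
  case (Cons x xs)
  show ?case
  proof (cases k)
    case (Suc j)
    have "of_int n * (2 ^ j * pochhammer (of_int (n + 2) / 2) j) = 2 ^ Suc j * pochhammer (of_int n / 2 :: real) (Suc j)"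
      by (simp add: pochhammer_rec add_divide_distrib)
    then show ?thesis using Cons.IH[of "w * n" "n + 2" j] Suc by (simp add: mult.assoc)
  qed simp
qed simp

lemma weighted_le_length: "weighted_le w n hs gs \<Longrightarrow> length hs = length gs"
  by (induction w n hs gs rule: weighted_le.induct) auto

lemma weighted_le_coef:
  "weighted_le w n hs gs \<Longrightarrow> of_int w * (2 ^ k * pochhammer (of_int n / 2) k) * coef hs k \<le> coef gs k"
proof (induction w n hs gs arbitrary: k rule: weighted_le.induct)
  case (2 w n h hs g gs)
  show ?case
  proof (cases k)
    case 0
    with "2.prems" show ?thesis
      by simp (metis of_int_le_iff of_int_mult)
  next
    case (Suc j)
    have "of_int n * (2 ^ j * pochhammer (of_int (n + 2) / 2) j) = 2 ^ Suc j * pochhammer (of_int n / 2 :: real) (Suc j)"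
      by (simp add: pochhammer_rec add_divide_distrib)
    then have "of_int w * (2 ^ k * pochhammer (of_int n / 2) k) * coef (h # hs) k
        = of_int (w * n) * (2 ^ j * pochhammer (of_int (n + 2) / 2) j) * coef hs j"
      by (simp only: Suc coef_simps of_int_mult mult.assoc)
    also have "\<dots> \<le> coef (g # gs) k" using "2.IH"[of j] "2.prems" by (simp only: Suc coef_simps weighted_le.simps)
    finally show ?thesis .
  qed
qed auto

lemma length_list_reflect [simp]: "length (list_reflect xs) = length xs"
proof (induction xs)
  case (Cons c xs)
  have *: "length (list_minus_shift a ys) = Suc (length ys)" for a ys
    by (induction ys arbitrary: a) auto
  have "length (list_horner_step c ys) = Suc (length ys)" for ys
    by (cases ys) (auto simp: *)
  with Cons show ?case by simp
qed simp

lemma length_list_weight [simp]: "length (list_weight w n xs) = length xs"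
  by (induction xs arbitrary: w n) auto

text \<open>
  The density bound obtained from a certificate. The variable of the lists is \<open>s = 2 * t\<close>, so that the real
  polynomials \<open>p\<close> and \<open>g\<close> in \<open>t\<close> have the coefficients of the lists times \<open>2 ^ k\<close>; for \<open>g\<close>, whose list is weighted, the
  weight \<open>2 ^ k * pochhammer m k\<close> has to be divided out as well.
\<close>

theorem center_density_le_certificate:
  fixes P :: "(real ^ 'n) set set"
  assumes P: "sphere_packing P"
    and n: "CARD('n) = n"
    and cert: "certificate n U num den a b kn kd A B C E"
  shows "center_density P \<le> ereal (of_int U / 100000)"
proof -
  have pos: "0 < num" "0 < den" "0 \<le> a" "0 < b" "0 < kn" "0 < kd" "0 \<le> U"
    and kappa: "num * kd * 1000000000000 \<le> 8 * den * kn * 3141592653588"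
    and U: "kn ^ n * a ^ 2 * 10000000000 \<le> U ^ 2 * b ^ 2 * kd ^ n"
    using cert by (simp_all only: certificate_def)
  define ps where "ps = list_times_linear num (- den) 0 (list_add (list_square A) (list_times_linear (- num) den 0 (list_square B)))"
  define h where "h = list_add (list_square C) (0 # list_square E)"
  define gs where "gs = list_reflect (list_weight 1 (int n) ps)"
  define d where "d = length ps - 1"
  have ineqs: "transform_ineqs (int n) a b ps gs h"
    using cert by (simp only: certificate_def poly_ineqs.simps ps_def h_def gs_def)
  obtain p0 ps' g0 gs' where pg: "ps = p0 # ps'" "gs = g0 # gs'"
    using ineqs by (cases ps; cases gs) auto
  have g0: "0 < g0" "p0 * b \<le> a * g0" and wle: "weighted_le 1 (int n) h gs"
    using ineqs by (auto simp: pg)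
  have len: "length ps \<le> Suc d" "length gs \<le> Suc d" "length h \<le> Suc d"
    using weighted_le_length[OF wle] by (auto simp: d_def gs_def)
  define m where "m = real CARD('n) / 2"
  have m: "m = of_int (int n) / 2" by (simp add: m_def n)
  have m0: "m > 0" by (simp add: m_def)
  have poch: "pochhammer m k > 0" for k using m0 by (rule pochhammer_pos)
  define p where "p k = 2 ^ k * coef ps k" for k
  define g where "g k = coef gs k / pochhammer m k" for k
  define t0 where "t0 = real_of_int num / (2 * of_int den)"
  have "center_density P \<le> ereal ((t0 / (4 * pi)) powr m * (p 0 / g 0))"
  proof (rule center_density_le_poly[OF P m_def])
    show "(\<Sum>k\<le>d. g k * pochhammer m k * x ^ k) = (\<Sum>k\<le>d. p k * pochhammer m k * (1 - x) ^ k)" for x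
    proof -
      have "(\<Sum>k\<le>d. g k * pochhammer m k * x ^ k) = (\<Sum>k\<le>d. coef gs k * x ^ k)"
        using poch by (intro sum.cong refl) (simp add: g_def less_imp_neq[symmetric])
      also have "\<dots> = list_poly gs x" using len by (simp add: list_poly_eq_sum)
      also have "\<dots> = list_poly (list_weight 1 (int n) ps) (1 - x)" by (simp add: gs_def list_poly_list_reflect)
      also have "\<dots> = (\<Sum>k\<le>d. coef (list_weight 1 (int n) ps) k * (1 - x) ^ k)"
        using len by (intro list_poly_eq_sum) simp
      also have "\<dots> = (\<Sum>k\<le>d. p k * pochhammer m k * (1 - x) ^ k)"
        by (intro sum.cong refl) (simp add: coef_list_weight p_def m)
      finally show ?thesis .
    qed
    show "t0 > 0" using pos by (simp add: t0_def)
    show "(\<Sum>k\<le>d. p k * t ^ k) \<le> 0" if t: "t \<ge> t0" for t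
    proof -
      have "(\<Sum>k\<le>d. p k * t ^ k) = list_poly ps (2 * t)"
        using len by (simp add: list_poly_eq_sum p_def power_mult_distrib mult_ac)
      also have "\<dots> = (of_int num - of_int den * (2 * t)) *
          ((list_poly A (2 * t))\<^sup>2 + (of_int den * (2 * t) - of_int num) * (list_poly B (2 * t))\<^sup>2)"
        by (simp add: ps_def list_poly_list_times_linear list_poly_list_add list_poly_list_square)
      also have "\<dots> \<le> 0"
      proof -
        have "of_int den * (2 * t) - of_int num \<ge> 0" using t pos by (simp add: t0_def field_simps)
        then show ?thesis by (intro mult_nonpos_nonneg add_nonneg_nonneg mult_nonneg_nonneg) auto
      qed
      finally show ?thesis .
    qed
    show "(\<Sum>k\<le>d. g k * t ^ k) \<ge> 0" if t: "t \<ge> 0" for t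
    proof -
      have "0 \<le> (list_poly C (2 * t))\<^sup>2 + 2 * t * (list_poly E (2 * t))\<^sup>2" using t by simp
      also have "\<dots> = list_poly h (2 * t)" by (simp add: h_def list_poly_list_add list_poly_list_square)
      also have "\<dots> = (\<Sum>k\<le>d. 2 ^ k * coef h k * t ^ k)"
        using len by (simp add: list_poly_eq_sum power_mult_distrib mult_ac)
      also have "\<dots> \<le> (\<Sum>k\<le>d. g k * t ^ k)"
      proof (intro sum_mono mult_right_mono)
        show "2 ^ k * coef h k \<le> g k" for k
          using weighted_le_coef[OF wle, of k, folded m] poch[of k]
          by (simp add: g_def pos_le_divide_eq mult_ac)
      qed (use t in auto)
      finally show ?thesis .
    qed
    show "g 0 > 0" using g0 by (simp add: g_def pg)
  qed
  also have "(t0 / (4 * pi)) powr m * (p 0 / g 0) \<le> of_int U / 100000"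
  proof -
    define k where "k = real_of_int kn / of_int kd"
    define q where "q = real_of_int a / of_int b"
    have k0: "k > 0" using pos by (simp add: k_def)
    have "real_of_int (num * kd * 1000000000000) \<le> of_int (8 * den * kn * 3141592653588)"
      using kappa by (simp only: of_int_le_iff)
    then have "of_int num * of_int kd \<le> 8 * of_int den * of_int kn * (3141592653588 / 1000000000000 :: real)"
      by (simp add: mult_ac)
    also have "\<dots> \<le> 8 * of_int den * of_int kn * pi"
      using pos pi_approx(1) by (intro mult_left_mono) auto
    finally have "t0 / (4 * pi) \<le> k"
      using pos by (simp add: t0_def k_def field_simps)
    then have 1: "(t0 / (4 * pi)) powr m \<le> k powr m"
      using pos m0 by (intro powr_mono2) (auto simp: t0_def)
    have "real_of_int (p0 * b) \<le> of_int (a * g0)" using g0 by (simp only: of_int_le_iff)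
    then have 2: "p 0 / g 0 \<le> q"
      using g0 pos by (simp add: p_def g_def pg q_def field_simps)
    have q0: "q \<ge> 0" using pos by (simp add: q_def)
    have "(t0 / (4 * pi)) powr m * (p 0 / g 0) \<le> (t0 / (4 * pi)) powr m * q"
      using 2 by (intro mult_left_mono) auto
    also have "\<dots> \<le> k powr m * q" using 1 q0 by (rule mult_right_mono)
    also have "\<dots> \<le> of_int U / 100000"
    proof (rule power2_le_imp_le)
      have "(k powr m)\<^sup>2 = k ^ n"
        using k0 by (simp add: m powr_realpow[symmetric] powr_powr flip: powr_numeral)
      then have "(k powr m * q)\<^sup>2 = k ^ n * q\<^sup>2" by (simp add: power_mult_distrib)
      also have "\<dots> = of_int (kn ^ n * a ^ 2) / of_int (kd ^ n * b ^ 2)"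
        by (simp add: k_def q_def power_divide)
      also have "\<dots> \<le> (of_int U / 100000)\<^sup>2"
      proof -
        have "real_of_int (kn ^ n * a ^ 2 * 10000000000) \<le> of_int (U ^ 2 * b ^ 2 * kd ^ n)"
          using U by (simp only: of_int_le_iff)
        then show ?thesis using pos by (simp add: field_simps)
      qed
      finally show "(k powr m * q)\<^sup>2 \<le> (of_int U / 100000)\<^sup>2" .
      show "0 \<le> real_of_int U / 100000" using pos by simp
    qed
    finally show ?thesis .
  qed
  finally show ?thesis by simp
qed

section \<open>The certificates for dimensions 2 to 36\<close>

text \<open>
  The equations that evaluate a certificate. Used on their own, without the default simplification rules and
  procedures, they keep the arithmetic with numbers of up to a few hundred bits fast.
\<close>

lemmas certificate_simps = certificate_def poly_ineqs.simps transform_ineqs.simps weighted_le.simps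
  list_weight.simps list_reflect.simps list_horner_step.simps list_minus_shift.simps list_times_linear.simps
  list_square.simps list_scale.simps list_add.simps arith_simps rel_simps
  power_numeral power_one of_nat_numeral Num.pow.simps Num.sqr.simps
  add_0_left add_0_right mult_zero_left mult_zero_right mult_1_left mult_1_right
  minus_zero diff_0 diff_0_right minus_minus simp_thms

lemma certificate_2:
  "certificate 2 28868 7429 1024 262159 262144 302685 1048576
    [-64194567813652611722117120, 26683861008469240471093248, -4493409440179813603082240,
      402234779224515108929536, -21088296414879563120640, 669194776147587497984, -12739063093796012032,
      137504809587703808, -726317422158848, 1206213514664]
    [-744788131699441558093824, 258257789250039030218752, -36102545008397551403008, 2670069195381309177856,
      -114611708790797500416, 2926994301474832384, -43429062736412672, 342410828800512, -1099511627776]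
    [7051216018499832939282432, -24573923785469224399405056, 13837628966509510016368640,
      -3117634375153211976712192, 352181737978634786832384, -21931543507018660708352, 781620203284881997824,
      -15778789190994493440, 166895185919279104, -715092253651456]
    [-18907655783412573101096960, 21237332213058233348128768, -7224903943260762028376064,
      1133822201215757060145152, -94367724940397174063104, 4441582325204437172224, -119971651155220496384,
      1801380906828038144, -13596842077487104, 38598832434704]"
  by (simp only: certificate_simps)

lemma certificate_3:
  "certificate 3 18616 8391 1024 16383 16384 341881 1048576
    [-102308629551796334475870208, 39287098753163479935352832, -6162476931731840363921408,
      517796066245339013709824, -25650838832119256449024, 773662139015034306560, -14072870500141367296,
      145780563534413824, -740409831447552, 1171423423920]
    [-1116876666622529872330752, 360738176789196352520192, -47341811042168652955648,
      3308659103306124099584, -134962526476683968512, 3292117566268375040, -46867269566857216,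
      355615357352448, -1099511627776]
    [8738203352845725793779712, -29712127940333274472120320, 16092668205667228313452544,
      -3470070755799004182740992, 376894462651680077905920, -22701649017103737421824, 787053539514271137792,
      -15543757032307032064, 161701882499616768, -684554943762928]
    [-23171709149499411627245568, 25221788169184031027494912, -8217429449884190952652800,
      1236614127442733469532160, -99261407178815721963520, 4532702487770935853056, -119531747807672139776,
      1764890761787441152, -13200835461350144, 37485549556069]"
  by (simp only: certificate_simps)

lemma certificate_4:
  "certificate 4 13126 9324 1024 4194375 4194304 189947 524288
    [-120591979670637072994324432551936, 50341057610015912067101678895104,
      -8922668878223349827362510340096, 885509177599903698284561039360, -54628484934569176120527159296,
      2196383096007189913046876160, -58553297843427735016308736, 1029233042617250223226880,
      -11564427955039459344384, 77337056321149599744, -262148687934669824, 281474976710656]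
    [-1248870135436301910716138389504, 452762181232777479442598461440, -69425382308016074506064887808,
      5937410342639874144890519552, -313989168357367818657726464, 10735646576063713216823296,
      -240362551555539781812224, 3477191972460316065792, -31046830195317538816, 153920939902369792,
      -319581045173126]
    [2732668599478882138752592904192, -11910645866064323159055830876160, 8224228132874314262822917242880,
      -2250009559199493491184113811456, 318691316873007182051215933440, -26199300957146652442768703488,
      1324481040721995040016039936, -42214391205189514887692288, 846578850243550153539584,
      -10319902838076720807936, 69625808787225067520, -198856757302388800]
    [-8178469942251405718409468444672, 11444088720523853130950923780096, -4721944281780595327240207597568,
      911241449679274258887906164736, -97371457187104498779429011456, 6247621613185555916021301248,
      -250547137720644803764420608, 6356677436573787598356480, -100569934929933904117760,
      944095356275357646848, -4682209515198687232, 9007199254626156]"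
  by (simp only: certificate_simps)

lemma certificate_5:
  "certificate 5 9975 10235 1024 524337 524288 104253 262144
    [-3179328395001432414637337790644224, 1249469160855074126109839812722688,
      -209435769688116086827629007601664, 19740332303255671943697524588544,
      -1161049648550231319065370034176, 44655302220866168565903917056, -1142117515364086900114587648,
      19306884975901450761666560, -208997241574519499390976, 1347748764994934145024, -4400484973776282624,
      4503599627370496]
    [-31426170238559531201811959513088, 10778341037162182474880499318784, -1570315089504325462692305305600,
      128088918137650530640554098688, -6482029324573501276555313152, 212687681771687210634969088,
      -4580780244982223714910208, 63867473428377826754560, -550268854190920564736, 2632967369764345856,
      -5267769916282902]
    [55713930002899302389159510933504, -239187727180829054724991415746560,
      161519234494211745109445030445056, -42993458090687154114701211729920, 5924024817864052096509551837184,
      -474648670545991378399653789696, 23435440949161653139090178048, -730884016860723968888274944,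
      14364932061139835463663616, -171832518326610191974400, 1138686425021399695360, -3196558778862927872]
    [-165585746057634153199783961952256, 227494474683076380914287820931072,
      -91499003858160807963773288579072, 17170907226650827448748561399808, -1786441946548168625467353464832,
      111835069296419648905257418752, -4384749941750724893805117440, 108958118853520613517033472,
      -1691065741979776565903360, 15594936480005424676864, -76075661353325428736, 144115188073046016]"
  by (simp only: certificate_simps)

lemma certificate_6:
  "certificate 6 8084 11128 1024 131069 131072 113349 262144
    [-323524363209023332552945245880320, 120270266260406230261006916911104,
      -19139132901972176977924907335680, 1718487665140653934501708169216, -96581454357102980711585939456,
      3559001632394692907107352576, -87409789816253151738593280, 1421467511559608439144448,
      -14820759341851184463872, 92085659753015934976, -289214157422936064, 281474976710656]
    [-3066891619521135642820120412160, 999009900385273785158129942528, -138713597969608074875958722560,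
      10816466250456634381828096000, -524651477322487509593096192, 16537057902962266379124736,
      -342768144761161529688064, 4605371953799887847424, -38263193794915336192, 176494264115795968,
      -339665815424740]
    [4508622263860855855794056331264, -19016301886033624989275881734144, 12538701814472831138350317436928,
      -3244509411504649601764915412992, 434437025290205994897148739584, -33876308528840113101150879744,
      1630917237504511874479161344, -49686516906193982502993920, 955533406661666741944320,
      -11200304614860006621184, 72819668552924463104, -200770067480936384]
    [-13289528892961851504005625151488, 17886777133610786374597251956736, -7005194083218604825059872735232,
      1277232383051864471236425809920, -129214661393523307021791657984, 7880013095350781338376470528,
      -301541968720024815691366400, 7326445952698462047830016, -111363598379920058744832,
      1007393581911890722816, -4828507645451872256, 9007199254725978]"
  by (simp only: certificate_simps)

lemma certificate_7:
  "certificate 7 6933 12005 1024 16385 16384 61141 131072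
    [-32129805805310484858282834919424, 11347557283406005410357007351808, -1720777193702087088715715313664,
      147653687812236662231669932032, -7950653462706513810460508160, 281335439792399509822111744,
      -6647603066345825664761856, 104158241727254471114752, -1047351907169266040832, 6276813270427893760,
      -18981944320638976, 17592186044416]
    [-293242569393838737227278974976, 91060506266471491347154993152, -12088266459270611524089020416,
      903497778770619856414834688, -42099089344350589080829952, 1277130098173458279038976,
      -25515670845134752186368, 330798785525364817920, -2653226632500740096, 11808627534406656,
      -21877140678146]
    [363516482539382313232149512192, -1504327813311783068882706628608, 967901971709531209827312730112,
      -243444387977992239198175756288, 31671048324706604778187128832, -2402692334787614938968883200,
      112749931961516508070281216, -3354785232679430107693056, 63132613035978181836800,
      -725460189810030804992, 4631685889702107136, -12558713826906848]
    [-1061951407608041109154435170304, 1398734456104746014932425768960, -533265726271080967906386771968,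
      94454401633373102832621715456, -9289485817165589067243454464, 551662379850722812312420352,
      -20597721269587756269436928, 489286012600577714814976, -7285938001288817016832, 64705155133775527936,
      -305272299753120256, 562949953418245]"
  by (simp only: certificate_simps)

lemma certificate_8:
  "certificate 8 6251 12868 1024 524365 524288 1048579 2097152
    [-3832900852855816969187508187316617216, 1466808334540014230613195921712742400,
      -246665888261943582908114193755406336, 24104866331841161921905974317154304,
      -1525273263709264241721269458829312, 65891035007839891914875664859136,
      -1995115090439640127940432232448, 42742013061948466656417153024, -644864015317417877892497408,
      6716056492879069329752064, -46307326140790060613632, 194958740778942201856, -421668280169664512,
      281474976710656]
    [-33788744829596647004027983686008832, 11586167534596881704826557136109568,
      -1740219152335332054100058864353280, 151361356234854176634684592619520,
      -8489027925609214055055072690176, 323297026178101265521268752384, -8567691822308331466335977472,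
      159028228148158932306624512, -2048375300564769742782464, 17805070412583679295488,
      -98662825554809454592, 310316765691834368, -412478400447986]
    [10958197488491861734093796291903488, -55709063842833360063495737035456512,
      44295445813830128223411370446553088, -13735018019261861418955776192413696,
      2222048177379914127978430973607936, -214087505291023427233560825692160,
      13174155010548009543243665506304, -538004328198689125583726575616, 14843018939235606171278639104,
      -276862577595131033269829632, 3428975131672559980904448, -26929951640096764444672,
      121072188922250777440, -236796122212066199]
    [-35388508977168022518944812438126592, 57609768465325201426925969414815744,
      -27091059180382715920310507673747456, 5930959022461736337692359517011968,
      -731995060357310441525608598994944, 56006791634292041359383249027072,
      -2798474268599507944489722314752, 93850953815793740036054188032, -2132639553705956066111520768,
      32600226239221244308226048, -326127094360075228413952, 2012079852790402893312, -6761856129158431150,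
      9007199254740535]"
  by (simp only: certificate_simps)

lemma certificate_9:
  "certificate 9 5900 13721 1024 32771 32768 139761 262144
    [-6118828667609912693426584274885148672, 2241554068150168473233467357681156096,
      -361585314504590022658654300593455104, 33961920115684085897983675986870272,
      -2069330949894371405481217334706176, 86227933603699542210568117026816,
      -2522310516353875474773136375808, 52273063281268557173911191552, -763775592183972798507515904,
      7709799408421048435081216, -51545618619160657395712, 210371961903631040512, -440255467601025024,
      281474976710656]
    [-52236661207103788541576551029800960, 17187013620069844944112146179948544,
      -2481899889506517792589312792985600, 207930546670371176517013279342592,
      -11251724053275831826968775491584, 414077355890044424735344820224, -10617986699809289213122183168,
      190914791349776722591481856, -2384191466528791962058752, 20103830076345169215488,
      -108073806607052963840, 329511976463284224, -423529986570062]
    [14157343746834112892294918649675776, -70932354950621992050282045630316544,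
      55392152802766098018883792885776384, -16817557530539102777454901910831104,
      2660554488229935394070523012972544, -250682440159478904587143654408192,
      15096117087683821291507923550208, -603846159160468118250570383360, 16332815571817593129532391424,
      -298937005115467343784312832, 3635790856720798571298816, -28060248852241824874496,
      124046493847900556288, -238685604056919134]
    [-45404585151652816368923123585646592, 72728083144191210603046530317287424,
      -33531907226428984096189561597591552, 7181682392367627498568380881829888,
      -866680456991075982995184974561280, 64868684037859632194547259277312,
      -3173339230933336716524784713728, 104288594675035636390353174528, -2324412838828346592035078144,
      34880300962439123443908608, -342799519774166571024384, 2079128007048924446720, -6872577096492946560,
      9007199254740535]"
  by (simp only: certificate_simps)

lemma certificate_10:
  "certificate 10 5804 14564 1024 2097259 2097152 593391 1048576
    [-153346496725686659609615487987311706112, 53913278831894914369563607109382176768,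
      -8361323518978038753980068356773904384, 756354452367514054098660457264971776,
      -44457063316107946919958317983858688, 1789744110634561658624121585532928,
      -50648135201028624154002941018112, 1016666730409026318799967617024, -14402066272362130336114540544,
      141048132392325171797557248, -915218912626198376873984, 3624074279844477665280, -7344968721285974016,
      4503599627370496]
    [-1270672185750250258351550153682321408, 402069880644899658221726832781164544,
      -55934642885198502318267542079012864, 4521825774011500307996278729474048,
      -236461073623376426454611457474560, 8420732847481495110154400563200, -209194475009214457258906222592,
      3647682240158227588882366464, -44209709439522931243745280, 361952543551774640832512,
      -1889244849180556918784, 5588350245602146304, -6951028959498666]
    [291582310228807969099214340600365056, -1438615202069996955848644792181325824,
      1102735352133544509033131058638356480, -327746909338374300138351538443649024,
      50701616969688473891121049397886976, -4672015826899406991447075177103360,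
      275353059072948122139999745343488, -10789635757939829199588124786688, 286174174399188328140511379456,
      -5141128152670487022852374528, 61429982164009895606616064, -466161792360149934931968,
      2027779320596487692288, -3841917770043790440]
    [-928316330749058738751357974822780928, 1461990285681299212824217252001742848,
      -660637296369312983484783912393113600, 138407141526218226504322113565884416,
      -16332290529395703016378210627616768, 1195892462541013608900946739331072,
      -57282159999485071910969460916224, 1845083372689694481178309951488, -40346143092335838029773012992,
      594558303908335963579875328, -5743475865483018546184192, 34270345837432219631616,
      -111546259849847825664, 144115188075851094]"
  by (simp only: certificate_simps)

lemma certificate_11:
  "certificate 11 5932 15399 1024 524239 524288 156853 262144
    [-14757511207639303192409061909763981312, 4990292432922563686602037258897850368,
      -745556521247347328807270805611216896, 65068209420974131578470538344923136,
      -3695294611014594131793132965068800, 143927697067570613478915817078784,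
      -3945353404843923066289406345216, 76793825097817655217309614080, -1055774566166201362989187072,
      10041046103166278292209664, -63287130902801600741376, 243342634618044022784, -478038781171709952,
      281474976710656]
    [-118923275428087062043788427080499200, 36260158527871176647029804526206976,
      -4868184152867215440533309947379712, 380346802775287597184448102137856,
      -19247687008595187068062239031296, 664109826491066715987603619840, -16001720718058483995260223488,
      270857678653925936081141760, -3188883517481167278309376, 25370828130632803024896,
      -128679689603479764992, 369559665590509568, -445184527626852]
    [23365638973918381847823766215720960, -113786462193521100484810329080987648,
      85834298018007227385127276178833408, -25038345221214210698600278252322816,
      3796509542727165864994150178357248, -342820186399593859892600603934720,
      19805769704252610406293027422208, -761155308959962731290172588032, 19810417812708377472146604032,
      -349398513828909913196199936, 4100149906554476561432576, -30564664636764196806656,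
      130625135000198646784, -243163770657139903]
    [-73929256667839587864143141435080704, 114758343176372269428913621543419904,
      -50957056102533589356337464468307968, 10469116851445687986254075618394112,
      -1210606335459195711853566023958528, 86876099550442753783064388698112,
      -4080148105578185594423895654400, 128930504736007131576626315264, -2767217386125696950813589504,
      40041555049989323647614976, -379903989835528814067712, 2226398611900841504256, -7114087636388303072,
      9007199254740764]"
  by (simp only: certificate_simps)

lemma certificate_12:
  "certificate 12 6279 16225 1024 65539 65536 330533 524288
    [-91527591419384425569391287774106670333952, 29828737716214482028627155007846207193088,
      -4300972610159360545998816460498958024704, 362761295650669327524010474606841298944,
      -19935417068289186640328686224212492288, 752250791403950000837820507637153792,
      -19999274907791170315041247724568576, 377895684834083743770481518444544,
      -5047375466784402252787544489984, 46661006831844105238630891520, -285929384251527097911083008,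
      1068484364450375177076736, -2036375863519160164352, 1152921504606846976]
    [-718554446410959712808718141945106399232, 211501198245276058102223740908584566784,
      -27449172829126365891122981253733679104, 2075748868097515341126530241382055936,
      -101793041624342547321309450089791488, 3407120572932877876273533526474752,
      -79713098357300379578510180614144, 1311171175442066653404913991680, -15009513512330302749837099008,
      116147540037404937947185152, -572915446238954850877440, 1598830408442633216000, -1866840961314816256]
    [122145950140123599504204591917386694656, -584735897981041594304124616545925070848,
      432331595152214153203232138898373083136, -123330353354662995305828611306754670592,
      18271248026656544503037875739902869504, -1612326678516312039828510520327012352,
      91102929191569640699632293330812928, -3428161178081689163064816540057600,
      87477971698411849010613281882112, -1514799280632006442801841569792, 17478259833482160991815860224,
      -128300878053328375691345920, 540748563213033093332992, -994163686679515117568]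
    [-383321272891638364400665262126864007168, 584051491987193469588021891392778272768,
      -253864370135314191883758538770679332864, 50973999928417957896931329671606304768,
      -5759153162096533171927726582071820288, 404028430419425562089767946374086656,
      -18568561263859774997461379827367936, 574896413719824658505471203737600,
      -12106300148285843594722435661824, 172131891745011977163840159744, -1607348898362492734385684480,
      9288423138783693627195392, -29340638909495054729216, 36893488147419007816]"
  by (simp only: certificate_simps)

lemma certificate_13:
  "certificate 13 6870 17046 1024 131043 131072 86815 131072
    [-8539490737334609207385423651559595573248, 2686644818147714426259365536714121543680,
      -374439520083779455490430801037234274304, 30563543023145779294090157499059535872,
      -1627336855538047770127997985938735104, 59559419597098968409646455500832768,
      -1537303871429768790452602149011456, 28225534605409000628395375067136,
      -366571210777849622658872770560, 3296663592027023249051222016, -19655168507379244586762240,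
      71436135178120394178560, -132192961564072886272, 72057594037927936]
    [-65406472849198145508719960019771064320, 18613230220565809046095307970793439232,
      -2338372902058276735944254768289939456, 171369005721362650868061427759841280,
      -8152848814342784626513526030073856, 264990860562432778701685932425216,
      -6025497901209466627400835006464, 96393697530469989205202173952, -1073764398648878855360610304,
      8087666066015778271920128, -38825915755748769398784, 105362677578810392576, -119338001302679518]
    [9699583162133589192588439570876465152, -45848769793803683923371944672938164224,
      33383047232618256503440771408797368320, -9355890754201139937161106187031150592,
      1359972119229116835312659300924522496, -117710918224795484328289196216156160,
      6524886745335665129954957403881472, -240960622319577402458794320986112,
      6036959213191327786507979194368, -102680436382265154191050670080, 1164105706910412422237913088,
      -8398403107138372896817152, 34794411070097556635648, -62887255193054034880]
    [-30256339868837035199043252342197583872, 45461147900354512626183229104856236032,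
      -19434218010523635369016099895479631872, 3830691217722356281612750048530006016,
      -424544043702125787639691347765493760, 29214478531468353254928340314226688,
      -1317404555015753574434984479948800, 40037750814034665366595429203968,
      -827972324346989168769288372224, 11565033245407416752858464256, -106116326291547187667009536,
      602582706250328416190464, -1869727932508527695872, 2305843009213661286]"
  by (simp only: certificate_simps)

lemma certificate_14:
  "certificate 14 7750 17859 1024 16387 16384 2910565 4194304
    [-785187800367809716537691739129829654528, 238870549578043483412301082457916047360,
      -32228055590210710582780518297126305792, 2549361757079185304425884105379414016,
      -131683899006393950615518715958001664, 4680087141729195586917906818007040,
      -117406596660694453593575941734400, 2096694774676083504046655143936, -26501982900640522869141405696,
      232060667845070346828906496, -1347291603119510516662272, 4766356605035889033216, -8571281651703803904,
      4503599627370496]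
    [-5875501948187117994572443086678392832, 1619005694086800147857981620329906176,
      -197159415024073858615638832200024064, 14020434759972590939728434589335552,
      -647858680515611743073922499739648, 20470179486161271873047216783360, -452830711843185887700112637952,
      7052112702492738278509248512, -76508351854979829112766464, 561371144122574034698240,
      -2624882815107125477376, 6932154860908822528, -7622448525986428]
    [766602761771988281708903138504736768, -3574855565262270644232714692117659648,
      2561180472491952651070555123859062784, -704716682258660448011350326355427328,
      100452392338904628884847428894720000, -8523790418805553072806227404128256,
      463327587277638719916047354298368, -16787545639839677396515607805952, 412914965241475382721506181120,
      -6899538378689127335795359744, 76894920630789577616916480, -545684803155744611893248,
      2225054512247421216768, -3960074268757665824]
    [-2375899649522777602773459840368902144, 3517270110731306430769690647241687040,
      -1477694553544818380187977796672290816, 285754466587603915244954682285621248,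
      -31048716837654376367156864734986240, 2094798491193693682451236039688192,
      -92654734328256268660959248121856, 2763631197330427468208375070720, -56127335563091628295098204160,
      770446943067771543259971584, -6951737398582733581582336, 38842021120535940562944,
      -118650256004549820416, 144115188075854537]"
  by (simp only: certificate_simps)

lemma certificate_15:
  "certificate 15 8999 18668 1024 262149 262144 760603 1048576
    [-1141222269748942691187339693220861837312, 336168219910563931927844111353395544064,
      -43961136065624833590661903523753492480, 3373945070098589240208189479609958400,
      -169247173434648152368993729809219584, 5846654295924382187291901467557888,
      -142678082441425123594483267534848, 2480344610697057651831068426240, -30535743903980490888941928448,
      260522355140303865941852160, -1473861276882447873605632, 5078757273996388990976, -8881875630610530304,
      4503599627370496]
    [-8352593420497397323870180273251418112, 2231328215146479984934441141258944512,
      -263694794231983486725286810980712448, 18214675870778544336589334318678016,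
      -818266292956239137723203671031808, 25155600256890368696877787906048, -541813739729266777633375387648,
      8220240044449895422980259840, -86917296801727749361238016, 621673918025271993171968,
      -2833121489235025592320, 7286239613903765504, -7783489753955048]
    [965325823911665057039739087835103232, -4440524881674175880203611987565871104,
      3130422568485749923108592822920413184, -845795125916753324956006824158429184,
      118257219589072571315705002267246592, -9840521221987790181963281593270272,
      524696932772027950541177175932928, -18658195842391884049983412895744, 450694379772514414247498743808,
      -7400731619763427239903887360, 81110703481702559235702784, -566408429180919747182592,
      2274052113590333587456, -3987308004562865572]
    [-2972386127358195013453039838418698240, 4335197958361097333160139163168669696,
      -1790109905935421943895246500127571968, 339691505339567523102115348598489088,
      -36196519275241334604598172838789120, 2395099158322796928152490033020928,
      -103941557586717922967154874908672, 3043689140036040614854338281472, -60727167007951449294339309568,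
      819477536548673379645784064, -7273879858425684765442048, 40007047073409972502528,
      -120376585253229274240, 144115188075855302]"
  by (simp only: certificate_simps)

lemma certificate_16:
  "certificate 16 10738 19472 1024 8387777 8388608 3173443 4194304
    [-419669975801620274278248665686007674306560, 119852684103169232384434649552271544680448,
      -15209558474478203354775425246309906382848, 1133794455578363924623864649318007832576,
      -55289170181130812053444538237290807296, 1858219036717374843828164524307906560,
      -44150267074037511239016904369635328, 747735819044677492848678970327040,
      -8972692475342136925413787566080, 74641229549281358354128568320, -411751745226130233950732288,
      1382936968253657942327296, -2353681353729656856576, 1152921504606846976]
    [-3007479109982365234478403050022738329600, 779820610415204127070333859807608438784,
      -89531119940795911527735354744918507520, 6013200537581783203094381396492288000,
      -262866790582150554614510927795453952, 7869489255995982913267895088709632,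
      -165161290693454899155629456228352, 2442957899801520283080556806144, -25192593017330483980031492096,
      175765427766800477467967488, -781196225238264768888832, 1957772168483300935680, -2033193995602889836]
    [309904446841040532466345098027393351680, -1406061790766683354932732853046474702848,
      975288063420259751181278815628724011008, -258766852995339089545384302057160179712,
      35493543929756228305835786781031661568, -2896921561364080446974234317553664000,
      151548507012465687076419762103779328, -5290232412096357538388050033246208,
      125527719865327272730311318831104, -2026265027430166755672810586112, 21846358848715265901502398464,
      -150182183537986693356322816, 593980927295109100953600, -1026628829331677679248]
    [-947994676096465942460505195943034880000, 1362028932501776881317619866222301544448,
      -552775544333326772652219471710067359744, 102943018886781902264400212471595401216,
      -10759257465320586578947627657992339456, 698363710133554436027886940501049344,
      -29742832729560506087684227714777088, 855260720140382782469830548127744,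
      -16768429089411512624434605195264, 222524091486321121628044394496, -1943839368684010598880509952,
      10529683140295650933735424, -31229492640531016678912, 36893488147419091845]"
  by (simp only: certificate_simps)

lemma certificate_17:
  "certificate 17 13150 20271 1024 1048755 1048576 825915 1048576
    [-2329058961262405577289610744357485281280, 645635024431401129869757015524477239296,
      -79595868452894821887006542245304205312, 5769001941918545997342772551433060352,
      -273741204777191897481396313800048640, 8958786084744247895246238117789696,
      -207408273078867369577065639575552, 3424763107589003390988199133184, -40085919297910980387186671616,
      325356192618586253142523904, -1751220516040050261098496, 5736546052486526402560, -9507962673016549376,
      4503599627370496]
    [-16358478073767628166651672193669267456, 4121531284362659150383529361271685120,
      -460170287441924959589973369934577664, 30079418982819773129427981262913536,
      -1280660884589445509404418925133824, 37365148288464627593210021019648,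
      -764718772975177233389670367232, 11035417899160335941908824064, -111063074170755457247870976,
      756328298264970630529024, -3280424261489342283776, 8016163405646370816, -8098700853715758]
    [1512131916126034808165256451577610240, -6779644738298847601654327372167512064,
      4636352206868601379904867931695087616, -1210376381727293064775147807104303104,
      163157133024987905891834845236035584, -13080990375052092079084472331403264,
      672202322365862046674373308317696, -23054981327006562169901734166528, 537665873980460442197214363648,
      -8533063361347871442364006400, 90483677529654320366092288, -611958599976118939615232,
      2381760280471112590080, -4051826361647915687]
    [-4599547921907729379919128341705129984, 6522811489568344485842637466086932480,
      -2607155363400363591261382890376658944, 477390762777299621586612612763746304,
      -49019987751047568858512793098256384, 3125369455391576473779481113264128,
      -130763640398642027970783967444992, 3694980434106635292738678947840, -71213635138177222600957100032,
      929288156602228717800914944, -7984674971518560871907328, 42550223582195598553088,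
      -124132218063985198896, 144115188075855628]"
  by (simp only: certificate_simps)

lemma certificate_18:
  "certificate 18 16503 21067 1024 65535 65536 858347 1048576
    [-838943009235754211865797575266171038466048, 225970109738112466629107351050809663029248,
      -27089669873327056466864928802199759224832, 1910694830281624689627677407354034323456,
      -88292014709041405767732731314008227840, 2815874095557241376749643203879108608,
      -63567831284068114400966408054767616, 1024040367290200272166859055300608,
      -11698568291302440123260108537856, 92696777874987689803685822464, -487097566938373237623488512,
      1557084594040418041069568, -2514810335973194170368, 1152921504606846976]
    [-5780043566285955619697760687561509961728, 1416385531134975233945545381291336138752,
      -153922991351619330940703930211574480896, 9800021950618523008828966286707916800,
      -406681193022056939358677638022430720, 11572110090740013017665156186898432,
      -231102226489539856163711387435008, 3255634403257657890845126295552, -31995656243783843062552199168,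
      212790278453140109893042176, -901156023523601898536960, 2148383815669875202048, -2112786248181975268]
    [481805967843215363601823443144797061120, -2132854696897153284399443443566457651200,
      1436861681777322165521085530532487364608, -368845981849353820208272248876885344256,
      48839811951653754352912249317937381376, -3845243626470590766589638022950551552,
      194071026203010037542206722229141504, -6539829442071788713898795239211008,
      149922682121587711720229890424832, -2340151621590919054920045821952, 24418873744084680523116445696,
      -162598782900804071010074624, 623365200762494562861056, -1045050778960068437248]
    [-1456688539567469611628994829000344862720, 2037275031771248904731381019504336175104,
      -801361376330901944871802071784504688640, 144196205649595579845481835163958640640,
      -14541234303198741438101212109467549696, 910456240591696902895961843727073280,
      -37419314078964720015902969069305856, 1039118711904045852413889670545408,
      -19691781996239992246243040428032, 252798226649602614413886488576, -2138009675041250000146268160,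
      11220014778568384417103872, -32247390384684791799808, 36893488147419076584]"
  by (simp only: certificate_simps)

lemma certificate_19:
  "certificate 19 21202 21859 1024 2097235 2097152 14249853 16777216
    [-1169293206821112597098427764325161732407296, 306325695140396289369435393998421363785728,
      -35742721760157655573658812308776342781952, 2455434295237637992564510199183994519552,
      -110585790289862764226276894824898494464, 3439541558249405907403965185721892864,
      -75766439771027633950896075858509824, 1191563725716225216778562766372864,
      -13294010159374951925849308266496, 102898235546462254335340314624, -528171519819246142299832320,
      1648549042937559162814464, -2596033463487048372224, 1152921504606846976]
    [-7908757904940572092249838570625872953344, 1886651955992775239576511296530857066496,
      -199732066639361267054460450386550456320, 12396268300691933215263872609897414656,
      -501769215488239983351572207679569920, 13934478794074609143117408769146880,
      -271720265439464237903314864308224, 3739077780930346868901914083328, -35904348864901884291863019520,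
      233329873481370028048646144, -965348856420957021011968, 2246526569831697371136, -2151824058584718086]
    [597536014162732145278208711231878987776, -2613636653559665172679972976094661836800,
      1735933707589546142453474376128770605056, -438535021549695609990042443679400984576,
      57082850228082984243903887617183186944, -4416281931734457078906241213272162304,
      219031695722888611575720117796864000, -7254996760830184322127468383174656,
      163539390172198287475786756653056, -2511087504399059683855554314240, 25786135536663638212412964864,
      -169040927943246924627312640, 638246202991685790072832, -1054133800495492595072]
    [-1796321573286823655381870545221455970304, 2479513094366129153212676426322319245312,
      -960613181850791278995365496170435575808, 169995503381719845085171142813267525632,
      -16847750905331986627313492706973450240, 1036550893208713839921784196427677696,
      -41868557303481494051259139131179008, 1143031089658790672659371433918464,
      -21303433404246503575082806280192, 269084043185012095465556017152, -2239956420567186569617735680,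
      11573778606330949241143296, -32756288190144958664704, 36893488147419076582]"
  by (simp only: certificate_simps)

lemma certificate_20:
  "certificate 20 27855 22648 1024 262145 262144 3691051 4194304
    [-1615665895784228712417423396065281289748480, 412040498240623406687306729860884651311104,
      -46833691809280327327195094896578593292288, 3136111931775657558209761587242213572608,
      -137759159591706893493555906652495937536, 4181452824381968355039937624044208128,
      -89935778179813438324803367904215040, 1381634732628682505525775795486720,
      -15062601328039064365150203019264, 113947584150493552950214918144, -571628103525054986321920000,
      1742994682866427219673088, -2677695128515097874432, 1152921504606846976]
    [-10735854811802332625404221926556351594496, 2495242723796928047098357565743888859136,
      -257536579106395115361135842564444782592, 15592498863499080007852103908322181120,
      -616038937017306118998311625744711680, 16706966346545142859350210624094208,
      -318292280510303805474520900304896, 4280773546776646543184878370816, -40184870023299150216320516096,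
      255311436434481340169060352, -1032447553320843316559872, 2346567595224560893952, -2190389467142772756]
    [738567327332002108779467738301641785344, -3191875564250928624736359457404758261760,
      2090090820025745653827400246371045867520, -519642448674497120367363951054576156672,
      66500706931722551234677428400594878464, -5056340398367808772584176837386567680,
      246469731182512777590169864916434944, -8025821466214947792213453687488512,
      177926631326462143364020354154496, -2688072673380286186985279717376, 27172319334707756163317891072,
      -175424586559855934849417216, 652577433600991563612160, -1062329041697067882176]
    [-2207640790855256159350373792852886945792, 3007424731942745250373951482134181969920,
      -1147605822411972720089900163046058229760, 199748865651063616240799809963231805440,
      -19458058720109017035532825172121747456, 1176521581014713987735764984844517376,
      -46711632861269792872634344982708224, 1253926469255014144997965757939712,
      -22989279586036331618636620890112, 285774048974583829319890501632, -2342221562525059502028357632,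
      11920506176059644659630080, -33241770096777394147328, 36893488147419095788]"
  by (simp only: certificate_simps)

lemma certificate_21:
  "certificate 21 37389 23434 1024 524317 524288 7638297 8388608
    [-2214110655352254371216490557870008921227264, 550147109792746883837857161199800759091200,
      -60961122127238654905660703438512729358336, 3981978794098007654592456726888644083712,
      -170720669724254444559582161274509721600, 5060340950390029380051964139726176256,
      -106335479016827281482815455084150784, 1596643288787958873469291497259008,
      -17018367493266764320860775907328, 125892794002805691102328258560, -617544756459095367060815872,
      1840448020454768564502528, -2759796549787903873024, 1152921504606846976]
    [-14463590227465375290779898434867353878528, 3277805080976810410313032158412481232896,
      -330062856475390834099926748179998965760, 19507632010042517681046149611028217856,
      -752757944105529152317941747835469824, 19948461591605301498970117385486336,
      -371519550901885942025316579934208, 4886125953178640644744880848896, -44862644301009314599307051008,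
      278798970829757289095757824, -1102512128448796580380672, 2448504926217607094272, -2228512799934670522]
    [909873189490926516768361417415248052224, -3886534034547616604632901796183605772288,
      2510058926130355431176656051579540996096, -614442307761638471417812830996481966080,
      77341935221864123423611145735842562048, -5781835381857315943484822760837873664,
      277098827912776608077806640052568064, -8873608219673095435039447780950016,
      193526284678133426368897676738560, -2877397261319699972228430954496, 28636712120551772985814417408,
      -182095187643945447467253760, 667445752958800109297664, -1070954443343731400076]
    [-2704656406670951596336212242303882887168, 3637653733459956778062446192824128897024,
      -1367782381317973376770593069760560234496, 234263144455668635452378013209095831552,
      -22439742678799553800971392906090774528, 1333962518590981898563893694002364416,
      -52077602127315985539848863316180992, 1375015958336306072716810892869632,
      -24804623061279543648873288302592, 303511462343034397641408512000, -2449593771841489387592351744,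
      12280663667017293971062784, -33741806894969778033792, 36893488147419101153]"
  by (simp only: certificate_simps)

lemma certificate_22:
  "certificate 22 51231 24218 1024 4193811 4194304 3946921 4194304
    [-188212487485468503297254804698337736916992, 45598109687971678935735944807464917008384,
      -4929300044581364166574103608878490976256, 314292595618300592937387816314048872448,
      -13159876587720161812838531694979973120, 381143032118304581219302455090610176,
      -7829241023033265042337790039162880, 114959465348070653373560179916800,
      -1198595559360354490213583552512, 8674391153877693131768463360, -41626098160842219521572864,
      121309302928511055429632, -177644872444217073664, 72057594037927936]
    [-1209425989850700625347605591513125355520, 267437963908794984687002546834432327680,
      -26291256086274262319489630765632716800, 1517819299179233299143766765624885248,
      -57237738475209205887596165041487872, 1482993455035615710829507994714112,
      -27013427659086775991470762491904, 347585882726868734268500082688, -3122951663347227034866679808,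
      18991818784968462028505088, -73476325874144147144704, 159520768875200794624, -141637253320779510]
    [69837359748584017513560976651634868224, -294999684914190648285621546262347120640,
      188016576813689088329967951411872268288, -45343368891631762736200438636657770496,
      5617115852842446479724851062898688000, -413080654887743326249420537028673536,
      19473560332147932605857695522619392, -613502539585436762299318623272960,
      13166601235158339440098714583040, -192701248623212049854491525120, 1888412351375019521291059200,
      -11827521693278668930678784, 42712478155172741150720, -67540247991545231016]
    [-206501217133212217756827817132792217600, 274355173556678803268758048773811208192,
      -101710543154285754871913216829588242432, 17151759030160515268691696976884924416,
      -1616457141831772397461446872807768064, 94521543077140564821678146388492288,
      -3629971731274527254931830499966976, 94301127992799914621079906156544,
      -1674257378969977192629881798656, 20168662596080070261158707200, -160298747167060528633741312,
      791552164205201785290752, -2142160644555422704160, 2305843009213693648]"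
  by (simp only: certificate_simps)

lemma certificate_23:
  "certificate 23 71601 24999 1024 8388919 8388608 1018551 1048576
    [-254067085960534856189171761693661813800960, 60060385668368182887176115682227968278528,
      -6338637219404767760319810363413898461184, 394762424039897751126345615902553145344,
      -16153097433335226387243708973123108864, 457394519797717387848489345071710208,
      -9189633409265306040079274741858304, 132022553329318803428768238010368,
      -1347139112134471947661707575296, 9542710934847735580369879040, -44818930259479044187750400,
      127781064290771639730176, -182829291630672076800, 72057594037927936]
    [-1606893478421471805618847497062734364672, 346952334196331401703229119966677565440,
      -33321012463622125471349691699823640576, 1880169707988607672781007141298241536,
      -69330647851229600336586255401746432, 1757215354584201748773006192148480,
      -31322849650337105422329715884032, 394511529809436260175886417920, -3470189196924372560241491968,
      20660946804985992027570176, -78237983422331765129216, 166127351843252813824, -143967754450689480]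
    [85491500855974503223899123642317930496, -357166838703127252708738362329593282560,
      224683477627655833222734745385543139328, -53394946885214158144009044906165141504,
      6511296826332688623018940341812199424, -471155724547612936813878168717885440,
      21853417641513481721217368335581184, -677478310198138783369222017777664,
      14310904039559951159057618829312, -206216879086350949185853849600, 1990312317599155704538595328,
      -12281117416353175552131072, 43706363066303181591552, -68126025290168323175]
    [-251474184332801733870735355382692052992, 330087584580209722343646138826158505984,
      -120676071644494063562434078689548304384, 20040904048157159384916624869714558976,
      -1858740074335591084140223992279597056, 106937552133882755390965577995517952,
      -4040815616164291292039711945654272, 103308884682203975329831098253312,
      -1805591686991395339412975910912, 21418202515922227940804263936, -167675469715260987714568192,
      815734263451084830261248, -2175081694589953773120, 2305843009213693648]"
  by (simp only: certificate_simps)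

lemma certificate_24:
  "certificate 24 101998 25778 1024 4195063 4194304 4201161 4194304
    [-5449658262078888655672154733556799266357248, 1257888492284289059067692110134752208486400,
      -129686775723063769609126418605888839352320, 7893832627287451861458954507636147486720,
      -315832664604724077282163722851708829696, 8748312109398586678726828510767218688,
      -171999635397990505897188311171072000, 2418864235468574053639886930444288,
      -24166384355135281637674675339264, 167631614402188249155355279360, -770896590565641956337123328,
      2151126596898806766239744, -3008624144576020140032, 1152921504606846976]
    [-33942565102086591767121390590973456678912, 7160448981362491804180190728657188159488,
      -672214037760886717043983370417036328960, 37093778967952412879843139714421882880,
      -1338215760663734066969846350671249408, 33196127752478177554710696686518272,
      -579331147926960710082814900436992, 7145603349386941664345716686848, -61561947086604805947881684992,
      358995839379313426438291456, -1331146824916967905820672, 2765608858054010101760, -2340373067491458784]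
    [1669363399105242648715752276144211099648, -6898748432555857575695915683894683238400,
      4284133899796676950843696377546487627776, -1003434595733969479443804264101165662208,
      120481606934895747948441704116332265472, -8580109365721081798344516997593694208,
      391643145622516279100332491201839104, -11949990639025262629022169670090752,
      248512094694504458680954251116544, -3526502316198393934128013639680, 33528968870634211849959112704,
      -203870278561123147888721920, 715169019231910931890176, -1099122506386827836800]
    [-4885241960059722160593259954006164242432, 6336159176252220165956776440088986910720,
      -2284725827471011407890333343078846300160, 373745502765971716847636066480531963904,
      -34121019805077517150005997722604142592, 1931869728952930104950379048270299136,
      -71842295771214919040290032770351104, 1808001010442459119904316993830912,
      -31113620337342623438220826771456, 363510184405708897075874234368, -2803714710575836470005727232,
      13441505724950292407255040, -35322545960499610981888, 36893488147419100052]"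
  by (simp only: certificate_simps)

lemma certificate_25:
  "certificate 25 148001 26556 1024 4194097 4194304 8655911 8388608
    [-1858483025667127729748249697522656498205851648, 419110769811964275825317834474281641801940992,
      -42235585573465717488279139883096186659274752, 2513969104880128968505986571816828967845888,
      -98401590959350872188298355786828627312640, 2667553548087427458788784831636447428608,
      -51346744655493443929186717632965902336, 707166011539484626316665002385211392,
      -6920531543153961901632412163506176, 47026675545937474050798554972160,
      -211839661806588053466187300864, 578783594573404938145103872, -791644487169156797710336,
      295147905179352825856]
    [-11404526767181117666158600930189380337795072, 2351981575676363056851734785651583259508736,
      -215950842157503188443574375183239346126848, 11659634392374484110438025614448872390656,
      -411733958206635774113482473491092471808, 10000880953705679128730415859882786816,
      -170950206063715659657631616284491776, 2065738744262079813231023036039168,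
      -17438220355189941753631362514944, 99638734600508836490766188544, -361911406742134839801020416,
      736009011491723732656128, -608476232323364302204]
    [520040849298529368029418079092763866955776, -2126051680990860298386064081636402701271040,
      1303516269177726179974708221115320011587584, -300964855400137646779277340483124400750592,
      35587737756575687967251242983478924410880, -2494829167756243652353816176090503184384,
      112092175162159034589382577840042541056, -3367027698107937512454522540977553408,
      68948987037584869814629802199482368, -963734883350337666399188608352256,
      9028345463741634492818163499008, -54107581773845238733336477696, 187139383302245543206453248,
      -283649666754393523644416]
    [-1514120999892396032440159842311309715570688, 1940677644072349854653396548197010624217088,
      -690310617743976223207340816201399406690304, 111254017539056801115322798709496629690368,
      -9999954678201952402526068071916350996480, 557303800307328012467851994864568762368,
      -20401006672030227009014142027400478720, 505490372518706948756948449780301824,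
      -8566981153676987501160930436186112, 98603170689012494054108562456576,
      -749439959670974823436040273920, 3541530485680420121554714624, -9174706797400170789371904,
      9444732965739290278752]"
  by (simp only: certificate_simps)

lemma certificate_26:
  "certificate 26 218614 27332 1024 2096993 2097152 8908847 8388608
    [-2460018019423915882951357054419234549839953920, 542336877823761421772910182305244048726687744,
      -53452195610589144144742318958862566321815552, 3112965290069185397723953288865982084808704,
      -119265726006714132768277013804026714652672, 3165813302498228446656656057564445802496,
      -59687846981029925227856042126875820032, 805404014980779491442354631148044288,
      -7723899229818169986095734857924608, 51437822036663813209522012422144,
      -227062417799927492126135287808, 607674459095214090876878848, -813179777359414892392448,
      295147905179352825856]
    [-14879988044105877859784467528047320845254656, 3001708881335629740442616250607096869945344,
      -269698871060748047246747747452399160131584, 14255083674548530822883681732094460952576,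
      -492970758509808292198266163176342028288, 11730205524770172596813762412719112192,
      -196481728850415751565624195384606720, 2327055768820571251028640533577728,
      -19255969315671538746262510632960, 107848571900983035559499792384, -383882856336513465338298368,
      764492055917008747995136, -617723382844297388460]
    [630939703026879412546744608493221841993728, -2552663094934394662819402618168385231388672,
      1545791160947884578936145057175939663790080, -351962586438218361256846487371908279959552,
      41001882808476396151907688685246443683840, -2830550136654297467731818127865141002240,
      125223129649934867025552537998699003904, -3704032260419911410545890345661497344,
      74707225517413850191569032981774336, -1028753135835062218464134330056704,
      9497346111659514394962938560512, -56106642335459404142480457728, 191337113586450229910306816,
      -286023287516995215195136]
    [-1827992141678693881949882549728843260755968, 2316208132660559693222433254849419560353792,
      -813059184151976584196008482367900668133376, 129150270672527849016876011261304439308288,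
      -11433486489817594904070391702554383745024, 627424484355680788572730579547754332160,
      -22615792198070641609747770139566145536, 551862266504318063338453420461785088,
      -9213057314913433104395513146376192, 104481266617767097499969803780096,
      -782646293857720212836849811456, 3645743030752966606189494272, -9310519701899908084195328,
      9444732965739290363872]"
  by (simp only: certificate_simps)

lemma certificate_27:
  "certificate 27 328537 28106 1024 2097561 2097152 36644527 33554432
    [-12641991592352949239503150898785515825266688, 2726197724258471959100525296698115877765120,
      -262929480917499922027970110538250216013824, 14990040266193955770245935630176325992448,
      -562418927892090020954756420672663060480, 14624950765393528224974586608818847744,
      -270204464863058089866448187210858496, 3573780284707828402933456531619840,
      -33599750728028588634295200907264, 219380544877570216887870029824, -949362580399712184175689728,
      2489700512063705105563648, -3260978938462315159552, 1152921504606846976]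
    [-75407748888957346025359775733132902268928, 14887711975075513473251910780298798825472,
      -1309644644090727697453680515092007878656, 67798382664982067530498529418320805888,
      -2297178779735602182256590588020260864, 53571912816064820864345992327069696,
      -879681248285060279831280050241536, 10215692461770224645258260512768, -82895545171813911799078584320,
      455273157644840750127513600, -1588672634470581349122048, 3099376501923106308096, -2448751143215322372]
    [2981364946261137618709572595255041064960, -11940283575401945766509674029977794772992,
      7143654540056523917187916123089561190400, -1604554945016769380458106878743705288704,
      184215412615242567082578466655636029440, -12527181428740949799964822654953717760,
      545844465567296981954467627886706688, -15903326643091333983616163907633152,
      315994521703245180435751801716736, -4287767898066851574373293228032, 39015281345095695159112237056,
      -227231629759614038912794624, 764152676964077506514944, -1126691487696421185068]
    [-8596607402831920077673308555616517619712, 10771312294103053990980179284128773963776,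
      -3732549501772051463827320398378373742592, 584552584234517183851967838874949910528,
      -50985434789108485068389524771698638848, 2755790130577552987042492466837061632,
      -97837108467508858591528869322293248, 2351708904096878584711283598163968,
      -38681667671234545698862241153024, 432303687176356349252930109440, -3191992296188576075064803328,
      14658848140460323290677248, -36907016912946676336768, 36893488147419102984]"
  by (simp only: certificate_simps)

lemma certificate_28:
  "certificate 28 502059 28880 1024 4193835 4194304 18826833 16777216
    [-16542687711830655806766501286179964276703232, 3491196467460572466948734497691306383376384,
      -329645289811161452963819842996501775122432, 18406037556604701781985283430039467065344,
      -676579291472187861981733785527612604416, 17242272066509542280594851177999368192,
      -312290128117603208684263853875265536, 4050063697887098961959160974934016,
      -37343086546787552862369778499584, 239132603242952325455482454016, -1014829031685967957612036096,
      2608849158977126293045248, -3345812804158033158144, 1152921504606846976]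
    [-97343616458351385569544444139444579074048, 18817800131640739955778645810752924942336,
      -1621446875094000441381088008215371710464, 82248441377089453147877500495012560896,
      -2731505762011547838908486706561810432, 62455261204305009057587713068236800,
      -1005745563498150200699747381018624, 11456223812524321620456879685632, -91192249291040100649214672896,
      491288097792798398684856320, -1681214091989262505345024, 3214268021510424809472, -2484144238537323296]
    [3596813517958978620338874320940404047872, -14262515850367544287399731411199278972928,
      8432367400687654060986556065701561368576, -1868902663379645216815562939578468794368,
      211516338336340030009123006025962618880, -14172715540398890887454688588052037632,
      608396670310171467227323852038078464, -17463993452255309168756249866534912,
      341931217572876152402401952792576, -4572817996935164111556324622336, 41018534144296231299935371264,
      -235562664222154959333883904, 781275631282518882922496, -1136322631366202573864]
    [-10322784705367055968487745356537299730432, 12792848455361789232475783770485194489856,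
      -4377278469486533132087224297036714082304, 676061684345223639079139368664020549632,
      -58112608220526330864006528530246533120, 3094616684413790989669319692018253824,
      -108239095995512982652743778308194304, 2563476841608479226831194545979392,
      -41552219411209771949000667168768, 457732024890857683232908902400, -3331982042311218044847783936,
      15087484738053824004030464, -37452914424990654272768, 36893488147419102651]"
  by (simp only: certificate_simps)

lemma certificate_29:
  "certificate 29 779782 29652 1024 4194473 4194304 19330099 16777216
    [-344381599415166253639094876787737640262696960, 71164440290607509592548493009856669662838784,
      -6581806490208894519841850336417204513275904, 360095584772093295633576820413134155022336,
      -12974112222168841088529696360008163262464, 324180028561291913568339619592043233280,
      -5758364022869358169753724921933987840, 73256668544051790606749207814471680,
      -662682691032331877438374941818880, 4163569943551770026854188056576, -17334145381928622713382895616,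
      43698132310356849539940352, -54895963366288447811584, 18446744073709551616]
    [-1999921471003038155518062854006062964539392, 378739486438249191763954961185666509045760,
      -31980869601107737355508669050525088481280, 1590276833946450198164392437372394930176,
      -51788822823054088262222067327748276224, 1161473842333823661698844549823070208,
      -18349919713784073504927917260406784, 205100561490145120531094786015232,
      -1602137090013876578503832371200, 8469842940305105809154506752, -28434503870291422222483456,
      53295072479391230853120, -40307355350897538344]
    [69228631099079212012213901051624159182848, -271836421683449091240047597939770666254336,
      158846102557163434946683140844501004713984, -34745163820235559854790908848023317512192,
      3877230979940053156956821617289199616000, -256034998780054752205906528270280556544,
      10830244783427280225231140125723852800, -306350763249440726243354410735370240,
      5911579355624008846471127241850880, -77934198477624243964871075430400, 689293719201047183659808849920,
      -3904027958940307566933049344, 12772951966080339288276992, -18329914656467471202032]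
    [-197772219068976190123292568803659325898752, 242453633124192648503224210321553083072512,
      -81929149575539095081001138006017752170496, 12481483568226011378212870754281944252416,
      -1057542074724689257072409172340849508352, 55495490879403811461507493102710947840,
      -1912676546828716030368184435851919360, 44641436433544153752566493991665664,
      -713234424862335970536686316683264, 7745870392253343201605114134528, -55599582839609285211133575168,
      248291730170969019986477056, -607870338439012388998144, 590295810358705645639]"
  by (simp only: certificate_simps)

lemma certificate_30:
  "certificate 30 1230390 30424 1024 4193291 4194304 19833365 16777216
    [-445854147312731445127083804221168517164040192, 90254097287232860604841758951085472682606592,
      -8179863416446842088262950600014495009996800, 438689439800906558645276651889473169129472,
      -15498498093566049654213041736039689879552, 379834633144206587347524248038895779840,
      -6619315338401731942492747772809183232, 82633465755486664452461686559866880,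
      -733617818348203929866599105822720, 4523801761729131974766450704384, -18482606037943397809108549632,
      45705824170483615732334592, -56264012941821587591168, 18446744073709551616]
    [-2556140106516206261278749000773139909574656, 474421717248744712578775751172280545181696,
      -39274229970435073262706376506457743949824, 1915213889866553753922129918429031825408,
      -61183111197151743362686968387875110912, 1346376763162484542956635595105894400,
      -20875936173760158248175145947496448, 229034920735842387777292504924160,
      -1756267703621417280976336191488, 9113841557701818952070463488, -30025753318920603798863872,
      55190320372256175562752, -40862786555464701976]
    [83061596706848718681783001789245786423296, -323039875589909186903974558939514172080128,
      186613583019088948957366979677044078542848, -40295437053895115014790535598603530928128,
      4434769514561689469350390438069664743424, -288690255490998740296519820576745848832,
      12036069912586289840995580197262589952, -335575073153438002447461025880997888,
      6383445705470034532114027983667200, -82973946932884455623738326515712, 723722176319380263929963872256,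
      -4043226122007891928202346496, 13051001833494003206635520, -18481345498916299693104]
    [-236224287227159337344478262050010064486400, 286534279493463030349945602048238504902656,
      -95646355207562556267150288793764167155712, 14376686238697389151364371739224349605888,
      -1201031988468217711126889700532789706752, 62122668150125877810242544680820539392,
      -2110303482142811157445116186511540224, 48549943554757638644417534177050624,
      -764713713550312824518689282850816, 8189078288697451044496616718336, -57971401109291028227685351424,
      255350799961822292487700480, -616603915825891957116928, 590295810358705645639]"
  by (simp only: certificate_simps)

lemma certificate_31:
  "certificate 31 1971397 31194 1024 4194687 4194304 40670653 33554432
    [-574164349677052884078048226011907424469909504, 113912385554345990350441861491292693101281280,
      -10121585327007917138043661949466098442174464, 532342947278845533518968834066178105147392,
      -18449396600089542583036351452608039223296, 443671715286172940359015312523490492416,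
      -7588524621592077699017299492140482560, 92995163884636914636488146627330048,
      -810568432115071312196399450292224, 4907414364995292441946001244160, -19682898649240173794142715904,
      47763902346477709234798592, -57637321813393462693888, 18446744073709551616]
    [-3250878134283440983995071577947187139575808, 591605904184955026514387076453214506188800,
      -48035325235244560003425888110337148846080, 2298166698377793462905286347142945832960,
      -72048273859682344183258993350747881472, 1556289378163366169326844176064577536,
      -23691265396554890575239634382487552, 255226427893079549141047989764096,
      -1921874777080789211280503209984, 9793147414884033506515615744, -31672888044583344414916608,
      57113506376023331942400, -41413305378375937260]
    [99377333531437167921048711110802595119104, -382878241615423121091197405046253276889088,
      218701330148621720584928267607011577823232, -46628390381598212439278902077182133141504,
      5062298555506463448532077444501155610624, -324926993103107311313954704937069838336,
      13354971659966912037828031779612655616, -367079339195728246787967634215272448,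
      6884791551057535097960675974053888, -88251313624976870534465212907520, 759250504694875848675461955584,
      -4184733053836716109048315904, 13329075014924692463173632, -18629022451380817196560]
    [-281383811655149780009393677321487410790400, 337771042123842871089872866118916626186240,
      -111399967586491687307329767582138539966464, 16524619671016144165568860363963081162752,
      -1361400280479631838740818211909155160064, 69423941397184351989410088714418257920,
      -2324900957802209862013979280805986304, 52732893545709449447659243537694720,
      -819013603926068976945010025955328, 8649819915588663239684262985728, -60401117619406887787830444032,
      262474030124561545053339648, -625276752194174418054144, 590295810358705647742]"
  by (simp only: certificate_simps)

lemma certificate_32:
  "certificate 32 3206222 31964 1024 8389615 8388608 10418645 8388608
    [-735983248532359189859545793501341728219594752, 143166932082618502987684392715886161173676032,
      -12476449070019771940877424994267948673662976, 643770290031213238238949112396635745288192,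
      -21894656544052724682340988080591686598656, 516825855935311763250838720493391970304,
      -8678864833570143298560318256908861440, 104439998610605826317960384406880256,
      -894021880447607745857708774916096, 5315867962852708374364951674880, -20937267487045351583875334144,
      49873383632071089975197696, -59015398624805125136384, 18446744073709551616]
    [-4116587667233464343136177041415242338271232, 734838460366298127140509353628838140051456,
      -58542189002899294856780687407099643166720, 2748893406657062874408393918883819421696,
      -84601551227764235967617855885009747968, 1794409443435508111961442595540828160,
      -26827332442391065697282949203886080, 283877908606824432932590213660672,
      -2099777483799193003278878113792, 10509621753284848401524981760, -33377715027119492147707904,
      59064610934016896733184, -41958546169540798648]
    [118596464895622096431260653439736212357120, -452739522862981248047383594527876670554112,
      255763910336073809503299517316798330437632, -53855659638124989573784128712040370929664,
      5769274554691075291713315430643877806080, -365211704617008081557687060674904064000,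
      14801639071087968469044638139390361600, -401176276110124906855051565941653504,
      7420279819433047846590026585473024, -93815648780273903331440859283456, 796243263006516481395137708032,
      -4330318412412627630321303552, 13612115308477830079201280, -18778699009644953407696]
    [-334359028448511279725036117836136131330048, 397281215417302025154760387882999672209408,
      -129489269214778111487347648302344820490240, 18960317784037271716570166295024862494720,
      -1540878889859622521955869836140987023360, 77486493376634032627434340501241724928,
      -2558712942800432167345064971048321024, 57230115295198256917571513886965760,
      -876633476701524247181684694319104, 9132506706482165735549967532032, -62915034884183492592693936128,
      269756079155731846149963776, -634042516339211167764480, 590295810358705647742]"
  by (simp only: certificate_simps)

lemma certificate_33:
  "certificate 33 5290924 32734 1024 2096927 2097152 21339251 16777216
    [-240432263839241400498070733063163147081656303616, 45875411529175704485543411953468591546650591232,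
      -3922515125246775226733485679718541163981963264, 198637240537167556161069086922820439406280704,
      -6631889442005879929773589577922903267082240, 153715198729606700765250976582201665126400,
      -2535128984796395128488464941388759302144, 29966883903674965486152577102796292096,
      -252004102348494148066722228182450176, 1472064213769057607869663574753280,
      -5695232622105657544191915327488, 13320808665240058015212634112, -15461912960490181953507328,
      4722366482869645213696]
    [-1328902769761538663115572774075212255287312384, 232774146657062396557211609878698651583250432,
      -18201972972046715115571624289509750849142784, 839125877702429750336817057738407716847616,
      -25361304560144797832609643782880859521024, 528361918517821536968851331184156737536,
      -7760342893367539012646825956713955328, 80683195876141793468630420638662656,
      -586401869357401357154387455115264, 2883717043298074661314273214464, -8996099595277900573677977600,
      15627104626304851767730176, -10879660689572570896568]
    [36141845972376503044353916193268286573510656, -136721570181138878184419587045885969862492160,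
      76397999658688677056182895735160965404033024, -15890308887128511274505171292454406099828736,
      1679917432714571926633567547495666568658944, -104899696125382175709986068171882242244608,
      4193015357611736307624881481702514360320, -112083126942607813265505254780627320832,
      2044842552422584975031528527990095872, -25504730238673188689476398169980928,
      213589791529516798229756860432384, -1146386136464657657504234209280, 3557118829824713784633065472,
      -4844847371464862931066880]
    [-101462227880013951490853929767924422223593472, 119343858376095773479438202375733276001173504,
      -38447549303660798358008867774440619036901376, 5557963052487889679709378443604124508356608,
      -445638562510046087728244469332450182430720, 22103079990044036304671980185856505806848,
      -719827296663784867109991650425521045504, 15879522101505713756898353389905117184,
      -239936119189162646290263240064630784, 2466072279256421612848088386371584,
      -16764155640230170868394158456832, 70935580391421642293406334976, -164540965093603144369700864,
      151115727451828646554368]"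
  by (simp only: certificate_simps)

lemma certificate_34:
  "certificate 34 8855925 33503 1024 4194187 4194304 43681121 33554432
    [-305414287390083805838207626508242842981010243584, 57182725798280348518061858734996683230675992576,
      -4799051391253868227425855351956807379213877248, 238600245857703130349578931704725327285583872,
      -7823016333166770343601127146412464224075776, 178106140421586684536254227079719756496896,
      -2885845960182333877939770276082108858368, 33519230099669833010152692251094941696,
      -277001842893531906642578556445523968, 1590120155627806958419993568477184,
      -6044876206159556873167807971328, 13887129339023667872550354944, -15817066997905864529551360,
      4722366482869645213696]
    [-1668581795223928169816134442130363089837621248, 286908994142694327717839620399874083374759936,
      -22029085581907801842201247350230417370251264, 997426407932964354219149646623204335157248,
      -29614188213291393880472489857096047656960, 606208061956347405442147714348913524736,
      -8749941474785431289829646182677217280, 89411210416647857608232052593786880,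
      -638716697846633868743798056550400, 3087029204230739961301570682880, -9462513176255229995599790080,
      16140644064574183331483648, -11016724370108420838664]
    [42912327881683036281377345800263343961800704, -160898951851796684207711706283433279948324864,
      88951194175333212301580720742908581271044096, -18279543800445924817994534070805117068640256,
      1907621412792870834581781084733413173231616, -117528581657121632268248640568883306037248,
      4634251858995828923705678680146743132160, -122200272578819194241598262808695275520,
      2199429301249530535092917205003665408, -27067833788116562736718911746605056,
      223703444410943039222044107472896, -1185122554348790519110337298432, 3630363497015049083668398080,
      -4882313481379165239682048]
    [-119970947965437899218889612768843825074405376, 139726408056688524146574099534642409826680832,
      -44502323589652049233644835959538867094159360, 6352880297509282245420642416756650045079552,
      -502673738873087400820270240478593472790528, 24596224028172287826754789589511984644096,
      -790164652605905546311144899523783950336, 17195697654416058942971667996546695168,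
      -256343892344350317972580289822588928, 2599829644628026468302509989429248,
      -17442126118256929068623845130240, 72846540574969982345635954688, -166777684290766459669561344,
      151115727451828646758992]"
  by (simp only: certificate_simps)

lemma certificate_35:
  "certificate 35 15029783 34272 1024 4193909 4194304 44683741 33554432
    [-24145969993098386621259439121435474791271235584, 4437797355114026844041652345660429520116645888,
      -365693478006130862536017485845345570580856832, 17856644315403306732193152320091548869984256,
      -575138264155435179510327123927506612125696, 12865873477908767272508660542209502740480,
      -204869405523832592208603630177284521984, 2338868695238994725981522012839870464,
      -18999502411354621560475850096246784, 107211312814632617048780325257216,
      -400583762662029453454756282368, 904168866985252984146886656, -1010833088063074596446208,
      295147905179352825856]
    [-130429230485843760951383093839104322637398016, 22023117165344209221509271593642274043461632,
      -1660910254498872311967910917586801955700736, 73883496524425426819655206325802588176384,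
      -2155643824349857941566050670049912422400, 43370286446962492298623963694444314624,
      -615371087313270386697103219825311744, 6182048620604466403191382568075264,
      -43418426833489959233195748622336, 206301270801524092249187549184, -621517161612241393661509632,
      1041320664082918502514688, -697034519856462282308]
    [3176728891137264190682841949656804390600704, -11808544317442967774101165399798691447963648,
      6460404007505019921144961003101995948572672, -1312064026077826464464622996996643214065664,
      135198625872096644922809058509189306908672, -8220595339148096638015772983977943498752,
      319838338665333018365811285285037670400, -8321464077081476322843954329654657024,
      147789399700214096900287620049797120, -1794922684803890257846370939437056,
      14641611805857331280447899959296, -76572339096573375895945871360, 231588875424405001356181504,
      -307548403229830696612864]
    [-8845517180673772126873345395546920570585088, 10203239578611229170073636379812945035526144,
      -3213612816974837707205492861089134178992128, 453150224329513850976706132166184831811584,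
      -35393501393215214014591602719721537929216, 1708949271884682221083651164612065230848,
      -54169477036489268804599218121071394816, 1163168493432615574040642770383667200,
      -17110885086486156214611672052006912, 171267875128565775976879177596928,
      -1134137322921150847086177026048, 4675659719840049389451083776, -10565958739045043922141184,
      9444732965739290400256]"
  by (simp only: certificate_simps)

lemma certificate_36:
  "certificate 36 25854994 35040 1024 4195339 4194304 22842529 16777216
    [-30412762987622949782168786223522002637443563520, 5488944724994014905976635884902795431037108224,
      -444278430561993740705303187986548554649829376, 21313614075678805022642771905607880425865216,
      -674598722790551159242340006062936442273792, 14832588281124544869798555091472180314112,
      -232185923621894619939669690206992203776, 2606189397880866656258472358061277184,
      -20817102035782520638682691870392320, 115504127148318792200786368528384,
      -424299285547752607976966324224, 941213580100404390142148608, -1033168742212430194282496,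
      295147905179352825856]
    [-162470242493210710346878558794943771845853184, 26948898115052290661747453103745474760802304,
      -1996982651504488976286362500541512465514496, 87304813929256349350119559320216778309632,
      -2503913221410248740578467810680103763968, 49529553957986165609063945855400148992,
      -691039672663588203114181070801600512, 6827092222361493275240822936174592,
      -47155147703779584325961065168896, 220331758485700680539044839424, -652587955231086595574595584,
      1074278487849226649112576, -705452278359757336972]
    [3753200332970944417387754723557284119576576, -13833162692056118934229438044009795975905280,
      7490467323082431061371627846935368299446272, -1503664682101940024959165239921124822745088,
      153012754929637002099572905003494374637568, -9183521739577281697286521845752673599488,
      352613910382628526792385684696226332672, -9053526581841418488421774453414821888,
      158686656464450320316946268146368512, -1902290568386567232422580630585344,
      15318688777897438920786149638144, -79100348920651696867609935872, 236248636050394635891310592,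
      -309868453504229388678784]
    [-10409359235389620757926013934312088831787008, 11893471987558461637105938543158226426265600,
      -3704909289255583085811097140478049802780672, 516124115541360176525393230487454075584512,
      -39798935183031186714439771248772918542336, 1896583532990744532327729361151879806976,
      -59326118250051502677694896488283373568, 1257166163597068494032494778432618496,
      -18252554719200195469396981464432640, 180337395350238947985637632901120,
      -1178942942308115790199487725568, 4798759158273432969769123840, -10706365851743371313561600,
      9444732965739290409652]"
  by (simp only: certificate_simps)

section \<open>The bounds\<close>

lemma upper_density_le_1:
  fixes P :: "(real ^ 'n) set set"
  shows "upper_density P \<le> 1"
  unfolding upper_density_def
proof (rule Limsup_bounded)
  have "\<forall>\<^sub>F r::real in at_top. r > 0" by (rule eventually_gt_at_top)
  then show "\<forall>\<^sub>F r in at_top. (SUP p. ereal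
      (measure lebesgue (ball p r \<inter> \<Union>P) / measure lebesgue (ball p r))) \<le> 1"
  proof eventually_elim
    case (elim r)
    have "measure lebesgue (ball p r \<inter> \<Union>P) \<le> measure lebesgue (ball p r)" for p
    proof (cases "ball p r \<inter> \<Union>P \<in> sets lebesgue")
      case True
      then show ?thesis by (intro measure_mono_fmeasurable) auto
    qed (simp add: measure_notin_sets)
    then have "measure lebesgue (ball p r \<inter> \<Union>P) / measure lebesgue (ball p r) \<le> 1" for p
      by (simp add: divide_le_eq_1 zero_less_measure_iff)
    then show ?case by (intro SUP_least) (simp add: one_ereal_def)
  qed
qed

lemma center_density_dim_1:
  fixes P :: "(real ^ 'n) set set"
  assumes "CARD('n) = 1"
  shows "center_density P \<le> ereal (1 / 2)"
proof -
  have "pi powr (real CARD('n) / 2) / Gamma (real CARD('n) / 2 + 1) = unit_ball_vol 1"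
    by (simp only: assms unit_ball_vol_def of_nat_1)
  also have "\<dots> = 2" by simp
  finally have "center_density P = upper_density P / ereal 2"
    by (simp only: center_density_def)
  also have "\<dots> \<le> ereal (1 / 2)"
    using upper_density_le_1[of P] by (subst ereal_divide_le_pos) (auto simp: one_ereal_def)
  finally show ?thesis .
qed

theorem mainTheorem4:
  fixes P :: "(real ^ 'n) set set" and n :: nat
  assumes "CARD('n) = n" and "1 \<le> n" and "n \<le> 36"
    and "sphere_packing P"
  shows "center_density P \<le> ereal (packing_bound n)"
proof -
  note bound = center_density_le_certificate[OF assms(4) assms(1)]
  have "n = 1 \<or> n = 2 \<or> n = 3 \<or> n = 4 \<or> n = 5 \<or> n = 6 \<or> n = 7 \<or> n = 8 \<or> n = 9 \<or> n = 10 \<or> n = 11 \<or> n = 12 \<or> n = 13 \<or> n = 14 \<or> n = 15 \<or> n = 16 \<or> n = 17 \<or> n = 18 \<or> n = 19 \<or> n = 20 \<or> n = 21 \<or> n = 22 \<or> n = 23 \<or> n = 24 \<or> n = 25 \<or> n = 26 \<or> n = 27 \<or> n = 28 \<or> n = 29 \<or> n = 30 \<or> n = 31 \<or> n = 32 \<or> n = 33 \<or> n = 34 \<or> n = 35 \<or> n = 36"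
    using assms(2,3) by presburger
  then show ?thesis
  proof (elim disjE)
    assume "n = 1"
    with center_density_dim_1[of P] assms(1) show ?thesis by (simp add: packing_bound_def)
  next
    assume n: "n = 2"
    show ?thesis using bound[unfolded n, OF certificate_2] by (simp add: n packing_bound_def)
  next
    assume n: "n = 3"
    show ?thesis using bound[unfolded n, OF certificate_3] by (simp add: n packing_bound_def)
  next
    assume n: "n = 4"
    show ?thesis using bound[unfolded n, OF certificate_4] by (simp add: n packing_bound_def)
  next
    assume n: "n = 5"
    show ?thesis using bound[unfolded n, OF certificate_5] by (simp add: n packing_bound_def)
  next
    assume n: "n = 6"
    show ?thesis using bound[unfolded n, OF certificate_6] by (simp add: n packing_bound_def)
  next
    assume n: "n = 7"
    show ?thesis using bound[unfolded n, OF certificate_7] by (simp add: n packing_bound_def)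
  next
    assume n: "n = 8"
    show ?thesis using bound[unfolded n, OF certificate_8] by (simp add: n packing_bound_def)
  next
    assume n: "n = 9"
    show ?thesis using bound[unfolded n, OF certificate_9] by (simp add: n packing_bound_def)
  next
    assume n: "n = 10"
    show ?thesis using bound[unfolded n, OF certificate_10] by (simp add: n packing_bound_def)
  next
    assume n: "n = 11"
    show ?thesis using bound[unfolded n, OF certificate_11] by (simp add: n packing_bound_def)
  next
    assume n: "n = 12"
    show ?thesis using bound[unfolded n, OF certificate_12] by (simp add: n packing_bound_def)
  next
    assume n: "n = 13"
    show ?thesis using bound[unfolded n, OF certificate_13] by (simp add: n packing_bound_def)
  next
    assume n: "n = 14"
    show ?thesis using bound[unfolded n, OF certificate_14] by (simp add: n packing_bound_def)
  next
    assume n: "n = 15"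
    show ?thesis using bound[unfolded n, OF certificate_15] by (simp add: n packing_bound_def)
  next
    assume n: "n = 16"
    show ?thesis using bound[unfolded n, OF certificate_16] by (simp add: n packing_bound_def)
  next
    assume n: "n = 17"
    show ?thesis using bound[unfolded n, OF certificate_17] by (simp add: n packing_bound_def)
  next
    assume n: "n = 18"
    show ?thesis using bound[unfolded n, OF certificate_18] by (simp add: n packing_bound_def)
  next
    assume n: "n = 19"
    show ?thesis using bound[unfolded n, OF certificate_19] by (simp add: n packing_bound_def)
  next
    assume n: "n = 20"
    show ?thesis using bound[unfolded n, OF certificate_20] by (simp add: n packing_bound_def)
  next
    assume n: "n = 21"
    show ?thesis using bound[unfolded n, OF certificate_21] by (simp add: n packing_bound_def)
  next
    assume n: "n = 22"
    show ?thesis using bound[unfolded n, OF certificate_22] by (simp add: n packing_bound_def)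
  next
    assume n: "n = 23"
    show ?thesis using bound[unfolded n, OF certificate_23] by (simp add: n packing_bound_def)
  next
    assume n: "n = 24"
    show ?thesis using bound[unfolded n, OF certificate_24] by (simp add: n packing_bound_def)
  next
    assume n: "n = 25"
    show ?thesis using bound[unfolded n, OF certificate_25] by (simp add: n packing_bound_def)
  next
    assume n: "n = 26"
    show ?thesis using bound[unfolded n, OF certificate_26] by (simp add: n packing_bound_def)
  next
    assume n: "n = 27"
    show ?thesis using bound[unfolded n, OF certificate_27] by (simp add: n packing_bound_def)
  next
    assume n: "n = 28"
    show ?thesis using bound[unfolded n, OF certificate_28] by (simp add: n packing_bound_def)
  next
    assume n: "n = 29"
    show ?thesis using bound[unfolded n, OF certificate_29] by (simp add: n packing_bound_def)
  next
    assume n: "n = 30"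
    show ?thesis using bound[unfolded n, OF certificate_30] by (simp add: n packing_bound_def)
  next
    assume n: "n = 31"
    show ?thesis using bound[unfolded n, OF certificate_31] by (simp add: n packing_bound_def)
  next
    assume n: "n = 32"
    show ?thesis using bound[unfolded n, OF certificate_32] by (simp add: n packing_bound_def)
  next
    assume n: "n = 33"
    show ?thesis using bound[unfolded n, OF certificate_33] by (simp add: n packing_bound_def)
  next
    assume n: "n = 34"
    show ?thesis using bound[unfolded n, OF certificate_34] by (simp add: n packing_bound_def)
  next
    assume n: "n = 35"
    show ?thesis using bound[unfolded n, OF certificate_35] by (simp add: n packing_bound_def)
  next
    assume n: "n = 36"
    show ?thesis using bound[unfolded n, OF certificate_36] by (simp add: n packing_bound_def)
  qed
qed

end
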